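(* With the notation of the context, let $$T=T_1^{[1]}=(s^{[1]}_{0}s^{[1]}_{4}s^{[1]}_{5}s^{[1]}_{6}s^{[1]}_{7}s^{[1]}_{3}s^{[1]}_{4}s^{[1]}_{5}s^{[1]}_{6}s^{[1]}_{2}s^{[1]}_{3}s^{[1]}_{4}s^{[1]}_{5}s^{[1]}_{1}s^{[1]}_{2}s^{[1]}_{3}s^{[1]}_{4})^2 .$$ Then $T$ satisfies $$\frac{T^{-1}(x)y-1}{T^{-1}(x)y-\frac{qh_2}{h_1}}\cdot\frac{xy-\frac{h_1}{h_2}}{xy-1}=\frac{\prod_{i=1}^4(y-\frac{e_i}{h_2})}{\prod_{i=5}^8(y-\frac1{e_i})},\qquad \frac{xT(y)-1}{\frac{qh_1}{h_2}xT(y)-1}\cdot\frac{\frac{h_2}{h_1}xy-1}{xy-1}=\frac{\prod_{i=1}^4(\frac{e_ix}{h_1}-1)}{\prod_{i=5}^8(\frac{x}{e_i}-1)}.$$ This pair of equations is equivalent, under the change of variables given in the context, to the $q$-$E_7^{(1)}$ equation $$\frac{(fg-\frac{\kappa_1}{\kappa_2})(f\underline g-\frac{q\kappa_1}{\kappa_2})}{(fg-1)(f\underline g-1)}=\frac{\prod_{i=1}^4(f-\frac{\kappa_1}{v_i})}{\prod_{i=5}^8(f-v_i)},\qquad \frac{(fg-\frac{\kappa_1}{\kappa_2})(\overline fg-\frac{\kappa_1}{q\kappa_2})}{(fg-1)(\overline fg-1)}=\frac{\prod_{i=1}^4(g-\frac{v_i}{\kappa_2})}{\prod_{i=5}^8(g-\frac1{v_i})},$$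 and its singular points are the eight points $$(x,y)=\Big(\frac{h_1}{e_i},\frac{e_i}{h_2}\Big)_{i=1,\dots,4},\quad \Big(e_i,\frac1{e_i}\Big)_{i=5,\dots,8}.$$
   Context: All maps are $\mathbb C$-automorphisms of the rational function field $K=\mathbb C(e_1,\dots,e_8,h_1,h_2,x,y)$; composition is $(\alpha\beta)(F)=\alpha(\beta(F))$ (rightmost factor first); generators of $K$ not mentioned are fixed. Put $q=h_1^2h_2^2/\prod_{i=1}^8e_i$. Representation 1 of the affine Weyl group of type $E_7^{(1)}$: $s_0^{[1]}:h_1\leftrightarrow h_2,\ x\mapsto 1/y,\ y\mapsto1/x$; for $(j;k,l)=(1;1,2),(2;2,3),(3;3,4),(5;5,6),(6;6,7),(7;7,8)$, $s_j^{[1]}:e_k\leftrightarrow e_l$; and $$s_4^{[1]}:\ e_4\mapsto\frac{h_2}{e_5},\ e_5\mapsto\frac{h_2}{e_4},\ h_1\mapsto\frac{h_1h_2}{e_4e_5},\ x\mapsto\frac{e_4(h_1-h_2)x+h_2(e_4e_5-h_1)xy-h_1(e_4e_5-h_2)}{e_4(e_4e_5-h_2)xy-e_4(e_4e_5-h_1)-e_4e_5(h_1-h_2)y}.$$ Change of variables: with an auxiliary variable $\lambda$ on which $T$ acts by $T(\lambda)=\lambda T(h_2)/h_1$, put $$v_i=\frac{e_i}{\lambda},\quad \kappa_1=\frac{h_2}{\lambda^2},\quad \kappa_2=\frac{h_1}{\lambda^2},\quad f=\frac1{\lambda y},\quad g=\frac{\lambda}{x},$$ and $\overline f=T(f)$,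 $\underline g=T^{-1}(g)$. (One has $T(h_2)=qh_1^2/h_2$ and $T^{-1}(h_1)=qh_2^2/h_1$, and the constraint $\kappa_1^2\kappa_2^2=q\prod_{i=1}^8v_i$.) Singular points: the points of $\mathbb P^1\times\mathbb P^1$ (coordinates $(x,y)$, parameters generic) at which the rational functions $T^{-1}(x)$, $T(y)$ of $(x,y)$ determined by the two equations are indeterminate. *)

theory Defs
  imports
    Complex_Main
    "HOL-Library.Poly_Mapping"
    "HOL-Computational_Algebra.Polynomial"
    "HOL-Computational_Algebra.Fraction_Field"
begin

datatype param =
  P_e1 | P_e2 | P_e3 | P_e4 | P_e5 | P_e6 | P_e7 | P_e8 | P_h1 | P_h2

datatype var = Par param | Var_x | Var_y

text \<open>
  The linear orders on the indeterminates have no mathematical role: the library proves that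
  \<^typ>\<open>('v \<Rightarrow>\<^sub>0 nat) \<Rightarrow>\<^sub>0 'a\<close> is an integral domain only for linearly ordered \<open>'v\<close>.
\<close>

fun param_rank :: "param \<Rightarrow> nat" where
  "param_rank P_e1 = 1" | "param_rank P_e2 = 2" | "param_rank P_e3 = 3" | "param_rank P_e4 = 4"
| "param_rank P_e5 = 5" | "param_rank P_e6 = 6" | "param_rank P_e7 = 7" | "param_rank P_e8 = 8"
| "param_rank P_h1 = 9" | "param_rank P_h2 = 10"

fun var_rank :: "var \<Rightarrow> nat" where
  "var_rank (Par p) = param_rank p" | "var_rank Var_x = 11" | "var_rank Var_y = 12"

lemma param_rank_le: "param_rank p \<le> 10"
  by (cases p) auto

lemma param_rank_inject: "param_rank p = param_rank r \<Longrightarrow> p = r"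
  by (cases p; cases r) auto

lemma var_rank_inject: "var_rank v = var_rank w \<Longrightarrow> v = w"
  using param_rank_le[of "case v of Par p \<Rightarrow> p | _ \<Rightarrow> P_e1"]
    param_rank_le[of "case w of Par p \<Rightarrow> p | _ \<Rightarrow> P_e1"]
  by (cases v; cases w) (auto intro: param_rank_inject)

instantiation param :: linorder
begin
definition "p \<le> r \<longleftrightarrow> param_rank p \<le> param_rank r" for p r :: param
definition "p < r \<longleftrightarrow> param_rank p < param_rank r" for p r :: param
instance
  by standard (auto simp: less_eq_param_def less_param_def intro: param_rank_inject)
end

instantiation var :: linorder
begin
definition "v \<le> w \<longleftrightarrow> var_rank v \<le> var_rank w" for v w :: var
definition "v < w \<longleftrightarrow> var_rank v < var_rank w" for v w :: var
instance
  by standard (auto simp: less_eq_var_def less_var_def intro: var_rank_inject)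
end

type_synonym 'v cpoly = "('v \<Rightarrow>\<^sub>0 nat) \<Rightarrow>\<^sub>0 complex"

type_synonym K = "var cpoly fract"

definition K_const :: "complex \<Rightarrow> K" where
  "K_const a = Fraction_Field.Fract (Poly_Mapping.single 0 a) 1"

definition K_gen :: "var \<Rightarrow> K" where
  "K_gen v = Fraction_Field.Fract (Poly_Mapping.single (Poly_Mapping.single v 1) 1) 1"

definition e_par :: "nat \<Rightarrow> param" where
  "e_par i = [P_e1, P_e2, P_e3, P_e4, P_e5, P_e6, P_e7, P_e8] ! (i - 1)"

definition K_e :: "nat \<Rightarrow> K" where "K_e i = K_gen (Par (e_par i))"
definition K_h1 :: K where "K_h1 = K_gen (Par P_h1)"
definition K_h2 :: K where "K_h2 = K_gen (Par P_h2)"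
definition K_x :: K where "K_x = K_gen Var_x"
definition K_y :: K where "K_y = K_gen Var_y"

definition field_automorphism :: "('a::field \<Rightarrow> 'a) \<Rightarrow> bool" where
  "field_automorphism \<sigma> \<longleftrightarrow>
     bij \<sigma> \<and> (\<forall>a b. \<sigma> (a + b) = \<sigma> a + \<sigma> b) \<and> (\<forall>a b. \<sigma> (a * b) = \<sigma> a * \<sigma> b)"

definition C_automorphism :: "(K \<Rightarrow> K) \<Rightarrow> bool" where
  "C_automorphism \<sigma> \<longleftrightarrow> field_automorphism \<sigma> \<and> (\<forall>a. \<sigma> (K_const a) = K_const a)"

definition aut_of :: "(var \<Rightarrow> K) \<Rightarrow> K \<Rightarrow> K" where
  "aut_of \<phi> = (THE \<sigma>. C_automorphism \<sigma> \<and> (\<forall>v. \<sigma> (K_gen v) = \<phi> v))"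

definition s4_x :: K where
  "s4_x =
     (K_e 4 * (K_h1 - K_h2) * K_x + K_h2 * (K_e 4 * K_e 5 - K_h1) * K_x * K_y
        - K_h1 * (K_e 4 * K_e 5 - K_h2))
     / (K_e 4 * (K_e 4 * K_e 5 - K_h2) * K_x * K_y - K_e 4 * (K_e 4 * K_e 5 - K_h1)
        - K_e 4 * K_e 5 * (K_h1 - K_h2) * K_y)"

text \<open>Only the indices \<open>0,\<dots>,7\<close> are meaningful.\<close>

definition s_images :: "nat \<Rightarrow> var \<Rightarrow> K" where
  "s_images j =
    (if j = 0 then
       K_gen(Par P_h1 := K_h2, Par P_h2 := K_h1, Var_x := 1 / K_y, Var_y := 1 / K_x)
     else if j = 4 then
       K_gen(Par P_e4 := K_h2 / K_e 5, Par P_e5 := K_h2 / K_e 4,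
             Par P_h1 := K_h1 * K_h2 / (K_e 4 * K_e 5), Var_x := s4_x)
     else
       K_gen(Par (e_par j) := K_e (j + 1), Par (e_par (j + 1)) := K_e j))"

definition s :: "nat \<Rightarrow> K \<Rightarrow> K" where
  "s j = aut_of (s_images j)"

definition T :: "K \<Rightarrow> K" where
  "T = foldr (\<circ>) (map s [0, 4, 5, 6, 7, 3, 4, 5, 6, 2, 3, 4, 5, 1, 2, 3, 4]) id ^^ 2"

definition q_of :: "(nat \<Rightarrow> 'a::field) \<Rightarrow> 'a \<Rightarrow> 'a \<Rightarrow> 'a" where
  "q_of e h1 h2 = h1^2 * h2^2 / (\<Prod>i=1..8. e i)"

text \<open>Here \<open>X\<close> stands for \<open>T\<inverse>(x)\<close> and \<open>Y\<close> for \<open>T(y)\<close>.\<close>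

definition xy_equation1 :: "(nat \<Rightarrow> 'a::field) \<Rightarrow> 'a \<Rightarrow> 'a \<Rightarrow> 'a \<Rightarrow> 'a \<Rightarrow> 'a \<Rightarrow> bool" where
  "xy_equation1 e h1 h2 x y X \<longleftrightarrow>
     (X * y - 1) / (X * y - q_of e h1 h2 * h2 / h1) * ((x * y - h1 / h2) / (x * y - 1))
     = (\<Prod>i=1..4. y - e i / h2) / (\<Prod>i=5..8. y - 1 / e i)"

definition xy_equation2 :: "(nat \<Rightarrow> 'a::field) \<Rightarrow> 'a \<Rightarrow> 'a \<Rightarrow> 'a \<Rightarrow> 'a \<Rightarrow> 'a \<Rightarrow> bool" where
  "xy_equation2 e h1 h2 x y Y \<longleftrightarrow>
     (x * Y - 1) / (q_of e h1 h2 * h1 / h2 * x * Y - 1) * ((h2 / h1 * x * y - 1) / (x * y - 1))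
     = (\<Prod>i=1..4. e i * x / h1 - 1) / (\<Prod>i=5..8. x / e i - 1)"

definition qE7_equation1 :: "(nat \<Rightarrow> 'a::field) \<Rightarrow> 'a \<Rightarrow> 'a \<Rightarrow> 'a \<Rightarrow> 'a \<Rightarrow> 'a \<Rightarrow> 'a \<Rightarrow> bool" where
  "qE7_equation1 v k1 k2 q f g g_under \<longleftrightarrow>
     ((f * g - k1 / k2) * (f * g_under - q * k1 / k2)) / ((f * g - 1) * (f * g_under - 1))
     = (\<Prod>i=1..4. f - k1 / v i) / (\<Prod>i=5..8. f - v i)"

definition qE7_equation2 :: "(nat \<Rightarrow> 'a::field) \<Rightarrow> 'a \<Rightarrow> 'a \<Rightarrow> 'a \<Rightarrow> 'a \<Rightarrow> 'a \<Rightarrow> 'a \<Rightarrow> bool" where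
  "qE7_equation2 v k1 k2 q f g f_over \<longleftrightarrow>
     ((f * g - k1 / k2) * (f_over * g - k1 / (q * k2))) / ((f * g - 1) * (f_over * g - 1))
     = (\<Prod>i=1..4. g - v i / k2) / (\<Prod>i=5..8. g - 1 / v i)"

type_synonym L = "K poly fract"

definition L_of :: "K \<Rightarrow> L" where
  "L_of F = Fraction_Field.Fract [:F:] 1"

definition L_lambda :: L where
  "L_lambda = Fraction_Field.Fract [:0, 1:] 1"

definition T_L :: "L \<Rightarrow> L" where
  "T_L = (THE \<sigma>. field_automorphism \<sigma> \<and> (\<forall>F. \<sigma> (L_of F) = L_of (T F))
                 \<and> \<sigma> L_lambda = L_lambda * L_of (T K_h2) / L_of K_h1)"

definition L_v :: "nat \<Rightarrow> L" where "L_v i = L_of (K_e i) / L_lambda"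
definition L_k1 :: L where "L_k1 = L_of K_h2 / L_lambda^2"
definition L_k2 :: L where "L_k2 = L_of K_h1 / L_lambda^2"
definition L_q :: L where "L_q = L_of (q_of K_e K_h1 K_h2)"

definition f_of :: "'a::field \<Rightarrow> 'a \<Rightarrow> 'a" where "f_of l y = 1 / (l * y)"
definition g_of :: "'a::field \<Rightarrow> 'a \<Rightarrow> 'a" where "g_of l x = l / x"

text \<open>Polynomials in \<open>x, y\<close>: the coefficient of \<open>x\<^sup>i y\<^sup>j\<close> in \<open>A\<close> is \<open>coeff (coeff A j) i\<close>.\<close>

type_synonym xypoly = "complex poly poly"
type_synonym xyfun = "xypoly fract"

datatype P1 = Affine complex | Infinity

fun homogeneous_coords :: "P1 \<Rightarrow> complex \<times> complex" where
  "homogeneous_coords (Affine a) = (a, 1)"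
| "homogeneous_coords Infinity = (1, 0)"

definition bidegree_le :: "nat \<Rightarrow> nat \<Rightarrow> xypoly \<Rightarrow> bool" where
  "bidegree_le m n A \<longleftrightarrow> degree A \<le> n \<and> (\<forall>j. degree (coeff A j) \<le> m)"

text \<open>Value at chosen homogeneous coordinates of the bihomogenization of bidegree \<open>(m, n)\<close>.\<close>

definition bihom_value :: "nat \<Rightarrow> nat \<Rightarrow> xypoly \<Rightarrow> P1 \<times> P1 \<Rightarrow> complex" where
  "bihom_value m n A p =
     (case (homogeneous_coords (fst p), homogeneous_coords (snd p)) of ((x0, x1), (y0, y1)) \<Rightarrow>
        \<Sum>i\<le>m. \<Sum>j\<le>n. coeff (coeff A j) i * x0 ^ i * x1 ^ (m - i) * y0 ^ j * y1 ^ (n - j))"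

text \<open>
  A rational function, seen as a rational map from \<open>\<P>\<^sup>1 \<times> \<P>\<^sup>1\<close> to \<open>\<P>\<^sup>1\<close> (so that a pole is not an
  indeterminacy), has a value at \<open>p\<close> if it is a quotient of two bihomogeneous polynomials of equal
  bidegree that do not both vanish at \<open>p\<close>.
\<close>

definition indeterminate_at :: "xyfun \<Rightarrow> P1 \<times> P1 \<Rightarrow> bool" where
  "indeterminate_at F p \<longleftrightarrow>
     \<not> (\<exists>m n A B. bidegree_le m n A \<and> bidegree_le m n B \<and> B \<noteq> 0 \<and> F = Fraction_Field.Fract A B
          \<and> (bihom_value m n A p \<noteq> 0 \<or> bihom_value m n B p \<noteq> 0))"

definition cpoly_eval :: "(complex \<Rightarrow> 'r::comm_semiring_1) \<Rightarrow> ('v \<Rightarrow> 'r) \<Rightarrow> 'v cpoly \<Rightarrow> 'r" where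
  "cpoly_eval \<iota> \<phi> P =
     (\<Sum>m\<in>Poly_Mapping.keys P. \<iota> (Poly_Mapping.lookup P m) *
        (\<Prod>v\<in>Poly_Mapping.keys m. \<phi> v ^ Poly_Mapping.lookup m v))"

fun spec_var :: "(param \<Rightarrow> complex) \<Rightarrow> var \<Rightarrow> xypoly" where
  "spec_var c (Par p) = [:[:c p:]:]"
| "spec_var c Var_x = [:[:0, 1:]:]"
| "spec_var c Var_y = [:0, 1:]"

definition spec_poly :: "(param \<Rightarrow> complex) \<Rightarrow> var cpoly \<Rightarrow> xypoly" where
  "spec_poly c = cpoly_eval (\<lambda>a. [:[:a:]:]) (spec_var c)"

text \<open>The right-hand \<open>G\<close> is unique when it exists.\<close>

definition specializes_to :: "(param \<Rightarrow> complex) \<Rightarrow> K \<Rightarrow> xyfun \<Rightarrow> bool" where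
  "specializes_to c F G \<longleftrightarrow>
     (\<exists>A B. spec_poly c B \<noteq> 0 \<and> F = Fraction_Field.Fract A B
          \<and> G = Fraction_Field.Fract (spec_poly c A) (spec_poly c B))"

definition xy_const :: "complex \<Rightarrow> xyfun" where
  "xy_const a = Fraction_Field.Fract [:[:a:]:] 1"

definition xy_x :: xyfun where "xy_x = Fraction_Field.Fract [:[:0, 1:]:] 1"
definition xy_y :: xyfun where "xy_y = Fraction_Field.Fract [:0, 1:] 1"

definition generically :: "((param \<Rightarrow> complex) \<Rightarrow> bool) \<Rightarrow> bool" where
  "generically Q \<longleftrightarrow>
     (\<exists>D :: param cpoly. D \<noteq> 0 \<and> (\<forall>c. cpoly_eval (\<lambda>a. a) c D \<noteq> 0 \<longrightarrow> Q c))"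

definition eight_points :: "(param \<Rightarrow> complex) \<Rightarrow> (P1 \<times> P1) set" where
  "eight_points c =
     (\<lambda>i. (Affine (c P_h1 / c (e_par i)), Affine (c (e_par i) / c P_h2))) ` {1..4}
     \<union> (\<lambda>i. (Affine (c (e_par i)), Affine (1 / c (e_par i)))) ` {5..8}"

end

theory Submission
  imports Defs "HOL-Computational_Algebra.Polynomial_Factorial" "HOL-Combinatorics.Transposition"
begin

text \<open>
  Put \<open>a\<^sub>i = e\<^sub>i\<close> for \<open>i \<le> 4\<close> and \<open>a\<^sub>i = h\<^sub>2 / e\<^sub>i\<close> for \<open>i \<ge> 5\<close>. The reflections \<open>s\<^sub>1, \<dots>, s\<^sub>7\<close> fix \<open>y\<close>
  and \<open>h\<^sub>2\<close>, permute the \<open>a\<^sub>i\<close> as adjacent transpositions, and fix both \<open>h\<^sub>1 a\<^sub>5 a\<^sub>6 a\<^sub>7 a\<^sub>8\<close> and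
  \<open>(x y - h\<^sub>1 / h\<^sub>2) / (x y - 1)\<close> times the product of the \<open>y - a\<^sub>i / h\<^sub>2\<close> over \<open>i \<ge> 5\<close>. Now
  \<open>T = (s\<^sub>0 w)\<^sup>2\<close>, where \<open>w\<close> exchanges the blocks \<open>a\<^sub>1, \<dots>, a\<^sub>4\<close> and \<open>a\<^sub>5, \<dots>, a\<^sub>8\<close>, and
  \<open>T\<inverse>(x) = w\<inverse>(x)\<close>; applying \<open>w\<inverse>\<close> to the second invariant gives the first equation. Since
  \<open>T(y) = 1 / s\<^sub>0(w(x))\<close>, the second equation is the image of the first one under \<open>s\<^sub>0\<close>.

  Each equation is of degree one in its unknown, whose solution is a quotient of two polynomials of
  bidegree \<open>(1,4)\<close>, respectively \<open>(4,1)\<close>. Their common zeros are the eight points, and there the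
  resultant shows that neither polynomial vanishes identically on the zero curve of the other.
\<close>

section \<open>Values of fractions under ring homomorphisms\<close>

text \<open>The automorphisms are given by description operators, so existence and uniqueness must
  precede any computation, and a substitution may annihilate the denominator of a fraction. Both
  difficulties are met by \<open>frac_val\<close>, the graph of a ring homomorphism extended to
  fractions as far as possible. The same device certifies by one numerical value that an element is
  nonzero, and it carries identities from \<open>K\<close> to specialized parameters.

  The word w has sixteen letters and is never expanded. Of its letters only \<open>s 4\<close> moves
  \<open>x\<close>, for fixed \<open>y\<close> by a Moebius transformation; the quotient in the
  second invariant is a coordinate in which \<open>s 4\<close> becomes multiplication by a factor
  free of \<open>x\<close>. The two invariants and the permutation of the a_i then determine w on
  \<open>h1\<close> and \<open>x\<close>.

  Since division by 0 yields 0, solving the equations requires nondegeneracy. It is checked at x = y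
  = 0, lifted to rational functions of \<open>x\<close> and \<open>y\<close>, and from there to
  \<open>K\<close>.\<close>

locale comm_ring_hom =
  fixes h :: "'a::comm_ring_1 \<Rightarrow> 'b::comm_ring_1"
  assumes hom_add: "h (a + b) = h a + h b"
    and hom_mult: "h (a * b) = h a * h b"
    and hom_one: "h 1 = 1"
begin

lemma hom_zero: "h 0 = 0"
  using hom_add[of 0 0] by simp

lemma hom_uminus: "h (- a) = - h a"
  using hom_add[of a "- a"] hom_zero by (simp add: add_eq_0_iff)

lemma hom_diff: "h (a - b) = h a - h b"
  using hom_add[of a "- b"] by (simp add: hom_uminus)

lemma hom_power: "h (a ^ n) = h a ^ n"
  by (induction n) (simp_all add: hom_one hom_mult)

lemma hom_sum: "h (sum f S) = (\<Sum>i\<in>S. h (f i))"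
  by (induction S rule: infinite_finite_induct) (simp_all add: hom_zero hom_add)

lemma hom_prod: "h (prod f S) = (\<Prod>i\<in>S. h (f i))"
  by (induction S rule: infinite_finite_induct) (simp_all add: hom_one hom_mult)

end

locale field_hom = comm_ring_hom h for h :: "'a::field \<Rightarrow> 'b::field"
begin

lemma hom_eq_0_iff: "h a = 0 \<longleftrightarrow> a = 0"
proof
  assume "h a = 0"
  then show "a = 0"
    using hom_mult[of a "inverse a"] hom_one by (cases "a = 0") auto
qed (simp add: hom_zero)

lemma hom_divide: "h (a / b) = h a / h b"
proof (cases "b = 0")
  case False
  then show ?thesis
    using hom_mult[of "a / b" b] by (simp add: hom_eq_0_iff eq_divide_eq)
qed (simp add: hom_zero)

lemma hom_inject: "h a = h b \<longleftrightarrow> a = b"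
  using hom_eq_0_iff[of "a - b"] by (simp add: hom_diff)

end

lemma field_automorphismD:
  assumes "field_automorphism \<sigma>"
  shows "field_hom \<sigma>" "bij \<sigma>"
proof -
  have *: "bij \<sigma>" "\<And>a b. \<sigma> (a + b) = \<sigma> a + \<sigma> b" "\<And>a b. \<sigma> (a * b) = \<sigma> a * \<sigma> b"
    using assms by (auto simp: field_automorphism_def)
  \<comment> \<open>Preservation of 1 is not part of the definition. With a preimage
    \<open>u\<close> of 1, multiplicativity at \<open>u * 1\<close> yields it.\<close>
  then obtain u where u: "\<sigma> u = 1"
    by (metis bij_pointE)
  have "\<sigma> 1 = 1"
    using *(3)[of u 1] u by simp
  with * show "field_hom \<sigma>"
    by unfold_locales auto
  show "bij \<sigma>"
    by fact
qed

lemma field_automorphismI: "field_hom \<sigma> \<Longrightarrow> bij \<sigma> \<Longrightarrow> field_automorphism \<sigma>"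
  by (simp add: field_automorphism_def comm_ring_hom.hom_add comm_ring_hom.hom_mult field_hom.axioms)

text \<open>A relation instead of a function, because \<open>h\<close> may annihilate denominators:
  \<open>F\<close> has a value as soon as one of its representations has a denominator outside the
  kernel of \<open>h\<close>.\<close>

definition frac_val :: "('r::idom \<Rightarrow> 'e::field) \<Rightarrow> 'r fract \<Rightarrow> 'e \<Rightarrow> bool" where
  "frac_val h F z \<longleftrightarrow> (\<exists>A B. h B \<noteq> 0 \<and> F = Fract A B \<and> z = h A / h B)"

locale frac_hom = comm_ring_hom h for h :: "'r::idom \<Rightarrow> 'e::field"
begin

lemma den_nonzero: "h B \<noteq> 0 \<Longrightarrow> B \<noteq> 0"
  using hom_zero by auto

lemma frac_val_unique:
  assumes "frac_val h F z" "frac_val h F w"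
  shows "z = w"
proof -
  obtain A B A' B' where *: "h B \<noteq> 0" "F = Fract A B" "z = h A / h B"
      "h B' \<noteq> 0" "F = Fract A' B'" "w = h A' / h B'"
    using assms unfolding frac_val_def by blast
  then have "A * B' = A' * B"
    using den_nonzero by (metis eq_fract(1))
  then have "h A * h B' = h A' * h B"
    by (metis hom_mult)
  then show ?thesis
    using *(1,3,4,6) by (simp add: frac_eq_eq)
qed

lemma frac_val_Fract: "h B \<noteq> 0 \<Longrightarrow> frac_val h (Fract A B) (h A / h B)"
  by (auto simp: frac_val_def)

lemma frac_val_to_fract: "frac_val h (to_fract A) (h A)"
  using frac_val_Fract[of 1 A] by (simp add: to_fract_def hom_one)

lemma frac_val_0: "frac_val h 0 0" and frac_val_1: "frac_val h 1 1"
  using frac_val_to_fract[of 0] frac_val_to_fract[of 1] by (simp_all add: hom_zero hom_one)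

lemma frac_val_add:
  assumes "frac_val h F z" "frac_val h G w"
  shows "frac_val h (F + G) (z + w)"
proof -
  obtain A B A' B' where *: "h B \<noteq> 0" "F = Fract A B" "z = h A / h B"
      "h B' \<noteq> 0" "G = Fract A' B'" "w = h A' / h B'"
    using assms unfolding frac_val_def by blast
  then have "F + G = Fract (A * B' + A' * B) (B * B')"
    using den_nonzero by simp
  then show ?thesis
    unfolding frac_val_def using *
    by (intro exI[of _ "A * B' + A' * B"] exI[of _ "B * B'"]) (simp add: hom_mult hom_add add_frac_eq)
qed

lemma frac_val_mult:
  assumes "frac_val h F z" "frac_val h G w"
  shows "frac_val h (F * G) (z * w)"
proof -
  obtain A B A' B' where *: "h B \<noteq> 0" "F = Fract A B" "z = h A / h B"
      "h B' \<noteq> 0" "G = Fract A' B'" "w = h A' / h B'"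
    using assms unfolding frac_val_def by blast
  then show ?thesis
    unfolding frac_val_def
    by (intro exI[of _ "A * A'"] exI[of _ "B * B'"]) (simp add: hom_mult)
qed

lemma frac_val_uminus: "frac_val h F z \<Longrightarrow> frac_val h (- F) (- z)"
  using frac_val_mult[OF frac_val_to_fract[of "- 1"]] by (simp add: hom_uminus hom_one)

lemma frac_val_diff: "frac_val h F z \<Longrightarrow> frac_val h G w \<Longrightarrow> frac_val h (F - G) (z - w)"
  using frac_val_add[OF _ frac_val_uminus] by fastforce

lemma frac_val_divide:
  assumes "frac_val h F z" "frac_val h G w" "w \<noteq> 0"
  shows "frac_val h (F / G) (z / w)"
proof -
  obtain A B where *: "h B \<noteq> 0" "G = Fract A B" "w = h A / h B"
    using assms unfolding frac_val_def by blast
  have "frac_val h (inverse G) (inverse w)"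
    unfolding frac_val_def using * assms(3)
    by (intro exI[of _ B] exI[of _ A]) auto
  then show ?thesis
    using frac_val_mult[OF assms(1)] by (simp add: divide_inverse)
qed

lemma frac_val_power: "frac_val h F z \<Longrightarrow> frac_val h (F ^ n) (z ^ n)"
  by (induction n) (simp_all add: frac_val_1 frac_val_mult)

lemma frac_val_prod: "(\<And>i. i \<in> S \<Longrightarrow> frac_val h (f i) (g i)) \<Longrightarrow> frac_val h (prod f S) (prod g S)"
  by (induction S rule: infinite_finite_induct) (simp_all add: frac_val_1 frac_val_mult)

lemma frac_val_sum: "(\<And>i. i \<in> S \<Longrightarrow> frac_val h (f i) (g i)) \<Longrightarrow> frac_val h (sum f S) (sum g S)"
  by (induction S rule: infinite_finite_induct) (simp_all add: frac_val_0 frac_val_add)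

lemmas frac_val_intros =
  frac_val_0 frac_val_1 frac_val_add frac_val_mult frac_val_diff frac_val_divide
  frac_val_power frac_val_prod

lemma frac_val_nonzero: "frac_val h F z \<Longrightarrow> z \<noteq> 0 \<Longrightarrow> F \<noteq> 0"
  using frac_val_unique frac_val_0 by blast

text \<open>With trivial kernel no denominator is lost, so every fraction has a value and
  \<open>frac_val\<close> is the graph of a field homomorphism.\<close>

lemma injective_extends:
  assumes inj: "\<And>A. h A = 0 \<Longrightarrow> A = 0"
  obtains \<sigma> where "field_hom \<sigma>" "\<And>A. \<sigma> (to_fract A) = h A"
proof -
  have ex: "\<exists>z. frac_val h F z" for F
  proof (cases F)
    case (Fract A B)
    then show ?thesis
      using frac_val_Fract[of B A] inj by blast
  qed
  define \<sigma> where "\<sigma> F = (THE z. frac_val h F z)" for F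
  have eq: "\<sigma> F = z" if "frac_val h F z" for F z
    unfolding \<sigma>_def using that frac_val_unique by blast
  have val: "frac_val h F (\<sigma> F)" for F
    using ex[of F] eq by blast
  have "field_hom \<sigma>"
    by unfold_locales (auto intro!: eq frac_val_add frac_val_mult frac_val_1 val)
  moreover have "\<sigma> (to_fract A) = h A" for A
    by (intro eq frac_val_to_fract)
  ultimately show thesis
    using that by blast
qed

end

lemma field_hom_fract_eqI:
  assumes "field_hom \<sigma>" "field_hom \<tau>" "\<And>A. \<sigma> (to_fract A) = \<tau> (to_fract A)"
  shows "\<sigma> = \<tau>"
proof
  fix F
  show "\<sigma> F = \<tau> F"
    using assms by (cases F) (simp add: Fract_conv_to_fract field_hom.hom_divide)
qed

section \<open>Evaluation of polynomials in several variables\<close>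

lemma poly_mapping_sum_single:
  "P = (\<Sum>m\<in>Poly_Mapping.keys P. Poly_Mapping.single m (Poly_Mapping.lookup P m))"
  by (rule poly_mapping_eqI)
    (auto simp: lookup_sum lookup_single when_def in_keys_iff)

definition monomial_eval :: "('v \<Rightarrow> 'r::comm_semiring_1) \<Rightarrow> ('v \<Rightarrow>\<^sub>0 nat) \<Rightarrow> 'r" where
  "monomial_eval \<phi> m = (\<Prod>v\<in>Poly_Mapping.keys m. \<phi> v ^ Poly_Mapping.lookup m v)"

lemma monomial_eval_superset:
  assumes "finite A" "Poly_Mapping.keys m \<subseteq> A"
  shows "monomial_eval \<phi> m = (\<Prod>v\<in>A. \<phi> v ^ Poly_Mapping.lookup m v)"
  unfolding monomial_eval_def using assms
  by (intro prod.mono_neutral_left) (auto simp: in_keys_iff)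

lemma monomial_eval_0: "monomial_eval \<phi> 0 = 1"
  by (simp add: monomial_eval_def)

lemma monomial_eval_single: "monomial_eval \<phi> (Poly_Mapping.single v n) = \<phi> v ^ n"
  by (simp add: monomial_eval_def)

lemma monomial_eval_add: "monomial_eval \<phi> (m + n) = monomial_eval \<phi> m * monomial_eval \<phi> n"
proof -
  let ?A = "Poly_Mapping.keys m \<union> Poly_Mapping.keys n"
  have "Poly_Mapping.keys (m + n) \<subseteq> ?A"
    by (rule keys_add)
  then show ?thesis
    by (simp add: monomial_eval_superset[of ?A] lookup_add power_add prod.distrib)
qed

locale poly_eval = comm_ring_hom \<iota> for \<iota> :: "complex \<Rightarrow> 'r::comm_ring_1"
begin

lemma cpoly_eval_superset:
  assumes "finite A" "Poly_Mapping.keys P \<subseteq> A"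
  shows "cpoly_eval \<iota> \<phi> P = (\<Sum>m\<in>A. \<iota> (Poly_Mapping.lookup P m) * monomial_eval \<phi> m)"
  unfolding cpoly_eval_def monomial_eval_def using assms
  by (intro sum.mono_neutral_left) (auto simp: in_keys_iff hom_zero)

lemma cpoly_eval_0: "cpoly_eval \<iota> \<phi> 0 = 0"
  by (simp add: cpoly_eval_def)

lemma cpoly_eval_monomial:
  "cpoly_eval \<iota> \<phi> (Poly_Mapping.single m a) = \<iota> a * monomial_eval \<phi> m"
  using cpoly_eval_superset[of "{m}" "Poly_Mapping.single m a"] by simp

lemma cpoly_eval_add: "cpoly_eval \<iota> \<phi> (P + Q) = cpoly_eval \<iota> \<phi> P + cpoly_eval \<iota> \<phi> Q"
proof -
  let ?A = "Poly_Mapping.keys P \<union> Poly_Mapping.keys Q"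
  have "Poly_Mapping.keys (P + Q) \<subseteq> ?A"
    by (rule keys_add)
  then show ?thesis
    by (simp add: cpoly_eval_superset[of ?A] lookup_add hom_add distrib_right sum.distrib)
qed

lemma cpoly_eval_sum: "cpoly_eval \<iota> \<phi> (sum f S) = (\<Sum>i\<in>S. cpoly_eval \<iota> \<phi> (f i))"
  by (induction S rule: infinite_finite_induct) (simp_all add: cpoly_eval_0 cpoly_eval_add)

lemma cpoly_eval_mult: "cpoly_eval \<iota> \<phi> (P * Q) = cpoly_eval \<iota> \<phi> P * cpoly_eval \<iota> \<phi> Q"
proof -
  let ?P = "\<lambda>m. Poly_Mapping.single m (Poly_Mapping.lookup P m)"
  let ?Q = "\<lambda>m. Poly_Mapping.single m (Poly_Mapping.lookup Q m)"
  have "P * Q = (\<Sum>m\<in>Poly_Mapping.keys P. \<Sum>n\<in>Poly_Mapping.keys Q. ?P m * ?Q n)"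
    by (subst poly_mapping_sum_single[of P], subst poly_mapping_sum_single[of Q]) (rule sum_product)
  also have "cpoly_eval \<iota> \<phi> \<dots>
      = (\<Sum>m\<in>Poly_Mapping.keys P. \<Sum>n\<in>Poly_Mapping.keys Q.
           (\<iota> (Poly_Mapping.lookup P m) * monomial_eval \<phi> m)
         * (\<iota> (Poly_Mapping.lookup Q n) * monomial_eval \<phi> n))"
    by (simp add: cpoly_eval_sum mult_single cpoly_eval_monomial monomial_eval_add hom_mult mult_ac)
  also have "\<dots> = cpoly_eval \<iota> \<phi> P * cpoly_eval \<iota> \<phi> Q"
    by (simp add: sum_product cpoly_eval_superset[OF finite_keys order_refl])
  finally show ?thesis .
qed

lemma cpoly_eval_const: "cpoly_eval \<iota> \<phi> (Poly_Mapping.single 0 a) = \<iota> a"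
  by (simp add: cpoly_eval_monomial monomial_eval_0)

lemma cpoly_eval_gen: "cpoly_eval \<iota> \<phi> (Poly_Mapping.single (Poly_Mapping.single v 1) 1) = \<phi> v"
  by (simp add: cpoly_eval_monomial monomial_eval_single hom_one)

lemma comm_ring_hom_cpoly_eval: "comm_ring_hom (cpoly_eval \<iota> \<phi>)"
  using cpoly_eval_const[of \<phi> 1]
  by unfold_locales (simp_all add: cpoly_eval_add cpoly_eval_mult hom_one)

end

lemma hom_cpoly_eqI:
  assumes "comm_ring_hom g" "comm_ring_hom h"
    and "\<And>a. g (Poly_Mapping.single 0 a) = h (Poly_Mapping.single 0 a)"
    and "\<And>v. g (Poly_Mapping.single (Poly_Mapping.single v 1) 1)
            = h (Poly_Mapping.single (Poly_Mapping.single v 1) 1)"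
  shows "g P = h (P :: 'v cpoly)"
proof -
  interpret g: comm_ring_hom g by fact
  interpret h: comm_ring_hom h by fact
  have gen_power: "g (Poly_Mapping.single (Poly_Mapping.single v n) 1)
      = h (Poly_Mapping.single (Poly_Mapping.single v n) 1)" for v n
  proof (induction n)
    case (Suc n)
    have "Poly_Mapping.single (Poly_Mapping.single v (Suc n)) (1::complex)
        = Poly_Mapping.single (Poly_Mapping.single v 1) 1 * Poly_Mapping.single (Poly_Mapping.single v n) 1"
      by (simp add: mult_single flip: single_add)
    then show ?case
      using Suc assms(4)[of v] by (simp add: g.hom_mult h.hom_mult)
  qed (simp add: g.hom_one h.hom_one)
  \<comment> \<open>Exponents add under multiplication, so a monomial is the product of the pure
    powers of its indeterminates, to which \<open>gen_power\<close> applies.\<close>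
  have mono_prod: "(\<Prod>v\<in>S. Poly_Mapping.single (f v) 1) = Poly_Mapping.single (sum f S) (1::complex)"
    for f :: "'v \<Rightarrow> 'v \<Rightarrow>\<^sub>0 nat" and S
    by (induction S rule: infinite_finite_induct) (simp_all add: mult_single)
  have mono: "g (Poly_Mapping.single m 1) = h (Poly_Mapping.single m 1)" for m
  proof -
    have "Poly_Mapping.single m (1::complex)
        = (\<Prod>v\<in>Poly_Mapping.keys m. Poly_Mapping.single (Poly_Mapping.single v (Poly_Mapping.lookup m v)) 1)"
      using mono_prod poly_mapping_sum_single[of m] by metis
    then show ?thesis
      by (simp add: g.hom_prod h.hom_prod gen_power)
  qed
  have "g (Poly_Mapping.single m a) = h (Poly_Mapping.single m a)" for m a
  proof -
    have "Poly_Mapping.single m a = Poly_Mapping.single 0 a * Poly_Mapping.single m 1"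
      by (simp add: mult_single)
    then show ?thesis
      using assms(3) mono by (simp add: g.hom_mult h.hom_mult)
  qed
  then have "(\<Sum>m\<in>Poly_Mapping.keys P. g (Poly_Mapping.single m (Poly_Mapping.lookup P m)))
      = (\<Sum>m\<in>Poly_Mapping.keys P. h (Poly_Mapping.single m (Poly_Mapping.lookup P m)))"
    by simp
  then show ?thesis
    using poly_mapping_sum_single[of P] by (metis (no_types) g.hom_sum h.hom_sum)
qed

section \<open>Automorphisms of the rational function field\<close>

lemma K_const_to_fract: "K_const a = to_fract (Poly_Mapping.single 0 a)"
  by (simp add: K_const_def to_fract_def)

lemma K_gen_to_fract: "K_gen v = to_fract (Poly_Mapping.single (Poly_Mapping.single v 1) 1)"
  by (simp add: K_gen_def to_fract_def)

interpretation K_const: poly_eval K_const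
  by unfold_locales (simp_all add: K_const_to_fract single_add mult_single flip: to_fract_add to_fract_mult)

lemma field_hom_K_eqI:
  assumes "field_hom \<sigma>" "field_hom \<tau>"
    and "\<And>a. \<sigma> (K_const a) = \<tau> (K_const a)" "\<And>v. \<sigma> (K_gen v) = \<tau> (K_gen v)"
  shows "\<sigma> = \<tau>"
proof (rule field_hom_fract_eqI[OF assms(1,2)])
  interpret \<sigma>: field_hom \<sigma> by fact
  interpret \<tau>: field_hom \<tau> by fact
  have "comm_ring_hom (\<lambda>A. \<sigma> (to_fract A))" "comm_ring_hom (\<lambda>A. \<tau> (to_fract A))"
    by (unfold_locales, simp_all add: \<sigma>.hom_add \<sigma>.hom_mult \<sigma>.hom_one \<tau>.hom_add \<tau>.hom_mult \<tau>.hom_one)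
  then show "\<sigma> (to_fract A) = \<tau> (to_fract A)" for A
    by (rule hom_cpoly_eqI) (use assms(3,4) in \<open>simp_all add: K_const_to_fract K_gen_to_fract\<close>)
qed

lemma frac_hom_K_eval: "frac_hom (cpoly_eval K_const \<phi>)"
  by (simp add: frac_hom_def K_const.comm_ring_hom_cpoly_eval)

text \<open>
  If substituting \<open>\<phi>\<close> into \<open>\<phi>\<close> makes sense and gives back the generators, then \<open>\<phi>\<close> is injective on
  polynomials, because substituting once more recovers the polynomial.
\<close>

lemma aut_of_involution:
  assumes "\<And>v. frac_val (cpoly_eval K_const \<phi>) (\<phi> v) (K_gen v)"
  shows "C_automorphism (aut_of \<phi>)" "aut_of \<phi> (K_gen v) = \<phi> v" "aut_of \<phi> (aut_of \<phi> F) = F"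
proof -
  define h where "h = cpoly_eval K_const \<phi>"
  interpret h: frac_hom h
    unfolding h_def by (rule frac_hom_K_eval)
  have h_const: "h (Poly_Mapping.single 0 a) = K_const a"
    and h_gen: "h (Poly_Mapping.single (Poly_Mapping.single v 1) 1) = \<phi> v" for a v
    by (simp_all only: h_def K_const.cpoly_eval_const K_const.cpoly_eval_gen)
  have val_gen: "frac_val h (\<phi> v) (K_gen v)" for v
    using assms by (simp add: h_def)
  have val_const: "frac_val h (K_const a) (K_const a)" for a
    using h.frac_val_to_fract[of "Poly_Mapping.single 0 a"] by (simp only: h_const flip: K_const_to_fract)
  have id: "cpoly_eval K_const K_gen = to_fract"
  proof
    interpret tf: comm_ring_hom "to_fract :: var cpoly \<Rightarrow> K"
      by unfold_locales simp_all
    show "cpoly_eval K_const K_gen A = to_fract A" for A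
      by (rule hom_cpoly_eqI[OF K_const.comm_ring_hom_cpoly_eval tf.comm_ring_hom_axioms])
        (simp_all only: K_const.cpoly_eval_const K_const.cpoly_eval_gen K_const_to_fract K_gen_to_fract)
  qed
  have val: "frac_val h (h A) (to_fract A)" for A
  proof -
    have "frac_val h (cpoly_eval K_const \<phi> A) (cpoly_eval K_const K_gen A)"
      unfolding cpoly_eval_def
      by (intro h.frac_val_sum h.frac_val_mult h.frac_val_prod h.frac_val_power val_gen val_const)
    then show ?thesis
      by (simp add: h_def id)
  qed
  have "A = 0" if "h A = 0" for A
    using val[of A] h.frac_val_0 h.frac_val_unique that by (metis to_fract_eq_0_iff)
  then obtain \<sigma> where "field_hom \<sigma>" and \<sigma>: "\<And>A. \<sigma> (to_fract A) = h A"
    using h.injective_extends by blast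
  interpret \<sigma>: field_hom \<sigma> by fact
  have \<sigma>_const: "\<sigma> (K_const a) = K_const a" and \<sigma>_gen: "\<sigma> (K_gen v) = \<phi> v" for a v
    by (simp_all only: K_const_to_fract K_gen_to_fract \<sigma> h_const h_gen)
  have \<sigma>_val: "\<sigma> F = z" if val_F: "frac_val h F z" for F z
  proof -
    obtain A B where "h B \<noteq> 0" "F = Fract A B" "z = h A / h B"
      using val_F unfolding frac_val_def by blast
    then show ?thesis
      by (simp add: Fract_conv_to_fract \<sigma>.hom_divide \<sigma>)
  qed
  have "field_hom (\<sigma> \<circ> \<sigma>)" "field_hom id"
    by unfold_locales (simp_all add: \<sigma>.hom_add \<sigma>.hom_mult \<sigma>.hom_one)
  then have "\<sigma> \<circ> \<sigma> = id"
    by (rule field_hom_K_eqI) (simp_all add: \<sigma>_const \<sigma>_gen \<sigma>_val[OF val_gen])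
  then have invol: "\<sigma> (\<sigma> F) = F" for F
    by (metis comp_apply id_apply)
  have "bij \<sigma>"
    using invol by (metis bijI')
  then have aut: "C_automorphism \<sigma>"
    by (simp add: C_automorphism_def field_automorphismI \<open>field_hom \<sigma>\<close> \<sigma>_const)
  have "aut_of \<phi> = \<sigma>"
    unfolding aut_of_def
  proof (rule the_equality)
    show "C_automorphism \<sigma> \<and> (\<forall>v. \<sigma> (K_gen v) = \<phi> v)"
      using aut \<sigma>_gen by simp
    show "\<tau> = \<sigma>" if "C_automorphism \<tau> \<and> (\<forall>v. \<tau> (K_gen v) = \<phi> v)" for \<tau>
      using that \<sigma>_const \<sigma>_gen
      by (intro field_hom_K_eqI \<open>field_hom \<sigma>\<close>) (auto simp: C_automorphism_def dest: field_automorphismD)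
  qed
  with aut \<sigma>_gen invol show "C_automorphism (aut_of \<phi>)" "aut_of \<phi> (K_gen v) = \<phi> v"
    "aut_of \<phi> (aut_of \<phi> F) = F" by simp_all
qed

section \<open>The generators\<close>

interpretation C_id: poly_eval "\<lambda>a::complex. a"
  by unfold_locales simp_all

lemma frac_hom_C_eval: "frac_hom (cpoly_eval (\<lambda>a::complex. a) c)"
  by (simp add: frac_hom_def C_id.comm_ring_hom_cpoly_eval)

lemma frac_val_K_gen:
  assumes "poly_eval \<iota>"
  shows "frac_val (cpoly_eval \<iota> c) (K_gen v) (c v)"
proof -
  interpret poly_eval \<iota> by fact
  interpret h: frac_hom "cpoly_eval \<iota> c"
    by (simp add: frac_hom_def comm_ring_hom_cpoly_eval)
  show ?thesis
    using h.frac_val_to_fract[of "Poly_Mapping.single (Poly_Mapping.single v 1) 1"]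
    by (simp only: cpoly_eval_gen K_gen_to_fract)
qed

text \<open>A point with distinct positive integer coordinates: 1 to 8 for the e_i, then 9, 10, 11,
  12 for h1, h2, x, y. An element of \<open>K\<close> with a nonzero value there is nonzero, so
  denominators are certified by arithmetic.\<close>

definition sample_point :: "var \<Rightarrow> complex" where
  "sample_point v = of_nat (var_rank v)"

interpretation sample: frac_hom "cpoly_eval (\<lambda>a::complex. a) sample_point"
  by (rule frac_hom_C_eval)

lemma e_par_simps [simp]:
  "e_par 1 = P_e1" "e_par (Suc 0) = P_e1" "e_par 2 = P_e2" "e_par (Suc (Suc 0)) = P_e2" "e_par 3 = P_e3" "e_par 4 = P_e4"
  "e_par 5 = P_e5" "e_par 6 = P_e6" "e_par 7 = P_e7" "e_par 8 = P_e8"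
  by (simp_all add: e_par_def)

lemmas K_defs = K_e_def K_h1_def K_h2_def K_x_def K_y_def

lemma sample_gens:
  "frac_val (cpoly_eval (\<lambda>a. a) sample_point) (K_e i) (of_nat (param_rank (e_par i)))"
  "frac_val (cpoly_eval (\<lambda>a. a) sample_point) K_h1 9"
  "frac_val (cpoly_eval (\<lambda>a. a) sample_point) K_h2 10"
  "frac_val (cpoly_eval (\<lambda>a. a) sample_point) K_x 11"
  "frac_val (cpoly_eval (\<lambda>a. a) sample_point) K_y 12"
  using frac_val_K_gen[OF C_id.poly_eval_axioms, of sample_point]
  by (auto simp: K_defs sample_point_def dest: meta_spec[of _ "Par _"] meta_spec[of _ Var_x])
    (metis sample_point_def var_rank.simps param_rank.simps of_nat_numeral)+

lemmas sample_intros = sample.frac_val_intros sample_gens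

lemma K_nonzero [simp]: "K_gen v \<noteq> 0" "K_e i \<noteq> 0" "K_h1 \<noteq> 0" "K_h2 \<noteq> 0" "K_x \<noteq> 0" "K_y \<noteq> 0"
proof -
  have "var_rank v \<noteq> 0" for v
  proof (cases v)
    case (Par p)
    then show ?thesis
      by (cases p) simp_all
  qed simp_all
  then show *: "K_gen v \<noteq> 0" for v
    using sample.frac_val_nonzero[OF frac_val_K_gen[OF C_id.poly_eval_axioms], of v]
    by (simp add: sample_point_def)
  show "K_e i \<noteq> 0" "K_h1 \<noteq> 0" "K_h2 \<noteq> 0" "K_x \<noteq> 0" "K_y \<noteq> 0"
    by (simp_all add: K_defs *)
qed

definition s4_num :: "'a::field \<Rightarrow> 'a \<Rightarrow> 'a \<Rightarrow> 'a \<Rightarrow> 'a \<Rightarrow> 'a \<Rightarrow> 'a" where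
  "s4_num e4 e5 h1 h2 x y = e4 * (h1 - h2) * x + h2 * (e4 * e5 - h1) * x * y - h1 * (e4 * e5 - h2)"

definition s4_den :: "'a::field \<Rightarrow> 'a \<Rightarrow> 'a \<Rightarrow> 'a \<Rightarrow> 'a \<Rightarrow> 'a \<Rightarrow> 'a" where
  "s4_den e4 e5 h1 h2 x y =
     e4 * (e4 * e5 - h2) * x * y - e4 * (e4 * e5 - h1) - e4 * e5 * (h1 - h2) * y"

lemma s4_x_eq: "s4_x = s4_num (K_e 4) (K_e 5) K_h1 K_h2 K_x K_y / s4_den (K_e 4) (K_e 5) K_h1 K_h2 K_x K_y"
  by (simp add: s4_x_def s4_num_def s4_den_def)

lemma s4_den_nonzero: "s4_den (K_e 4) (K_e 5) K_h1 K_h2 K_x K_y \<noteq> 0"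
  unfolding s4_den_def
  by (rule sample.frac_val_nonzero) (rule sample_intros | simp)+

text \<open>This is the denominator of \<open>s4_x\<close> after the substitution
  \<open>s 4\<close>; its nonvanishing makes that substitution into \<open>s4_x\<close>
  meaningful.\<close>

lemma s4_den_twice_nonzero:
  "s4_den (K_h2 / K_e 5) (K_h2 / K_e 4) (K_h1 * K_h2 / (K_e 4 * K_e 5)) K_h2 s4_x K_y \<noteq> 0"
  unfolding s4_den_def s4_x_def
  by (rule sample.frac_val_nonzero) (rule sample_intros | simp)+

text \<open>For fixed \<open>y\<close> the map from \<open>x\<close> to \<open>X\<close> is a
  Moebius transformation. Replacing \<open>e4\<close>, \<open>e5\<close>, \<open>h1\<close> by their
  images turns its matrix into a multiple of the adjugate, so the second application undoes the
  first.\<close>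

lemma s4_involution:
  fixes x y :: "'a::field"
  assumes "e4 \<noteq> 0" "e5 \<noteq> 0" "h2 \<noteq> 0"
    and "X = s4_num e4 e5 h1 h2 x y / s4_den e4 e5 h1 h2 x y"
    and "s4_den e4 e5 h1 h2 x y \<noteq> 0"
    and "s4_den (h2 / e5) (h2 / e4) (h1 * h2 / (e4 * e5)) h2 X y \<noteq> 0"
  shows "s4_num (h2 / e5) (h2 / e4) (h1 * h2 / (e4 * e5)) h2 X y
       / s4_den (h2 / e5) (h2 / e4) (h1 * h2 / (e4 * e5)) h2 X y = x"
proof -
  define D where "D = s4_den e4 e5 h1 h2 x y"
  define M where "M = s4_num e4 e5 h1 h2 x y"
  have D: "D \<noteq> 0" and X: "X = M / D"
    using assms by (simp_all add: D_def M_def)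
  \<comment> \<open>Clearing denominators leaves \<open>h2\<^sup>2\<close> times the adjugate matrix
    applied to the vector (M, D); this is its first component, \<open>den\<close> the
    second.\<close>
  have num: "s4_num (h2 / e5) (h2 / e4) (h1 * h2 / (e4 * e5)) h2 X y * (D * e4\<^sup>2 * e5\<^sup>2)
     = h2\<^sup>2 * (e4 * (h1 - e4 * e5) * M + e4 * e5 * (h2 - h1) * M * y - h1 * (h2 - e4 * e5) * D)"
    using assms(1-3) D unfolding s4_num_def X
    by (simp add: field_simps power2_eq_square)
  have den: "s4_den (h2 / e5) (h2 / e4) (h1 * h2 / (e4 * e5)) h2 X y * (D * e4\<^sup>2 * e5\<^sup>2)
     = h2\<^sup>2 * (e4 * (h2 - e4 * e5) * M * y - e4 * (h2 - h1) * D - h2 * (h1 - e4 * e5) * y * D)"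
    using assms(1-3) D unfolding s4_den_def X
    by (simp add: field_simps power2_eq_square)
  have "e4 * (h1 - e4 * e5) * M + e4 * e5 * (h2 - h1) * M * y - h1 * (h2 - e4 * e5) * D
     = x * (e4 * (h2 - e4 * e5) * M * y - e4 * (h2 - h1) * D - h2 * (h1 - e4 * e5) * y * D)"
    unfolding M_def D_def s4_num_def s4_den_def by algebra
  with num den have "s4_num (h2 / e5) (h2 / e4) (h1 * h2 / (e4 * e5)) h2 X y * (D * e4\<^sup>2 * e5\<^sup>2)
     = x * s4_den (h2 / e5) (h2 / e4) (h1 * h2 / (e4 * e5)) h2 X y * (D * e4\<^sup>2 * e5\<^sup>2)"
    by (simp add: mult.assoc mult.left_commute)
  then have "s4_num (h2 / e5) (h2 / e4) (h1 * h2 / (e4 * e5)) h2 X y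
     = x * s4_den (h2 / e5) (h2 / e4) (h1 * h2 / (e4 * e5)) h2 X y"
    using assms(1,2) D by simp
  then show ?thesis
    using assms(6) by simp
qed

abbreviation K_subst :: "(var \<Rightarrow> K) \<Rightarrow> var cpoly \<Rightarrow> K" where
  "K_subst \<phi> \<equiv> cpoly_eval K_const \<phi>"

lemma K_subst_gens:
  "frac_val (K_subst \<phi>) (K_gen v) (\<phi> v)"
  "frac_val (K_subst \<phi>) (K_e i) (\<phi> (Par (e_par i)))"
  "frac_val (K_subst \<phi>) K_h1 (\<phi> (Par P_h1))"
  "frac_val (K_subst \<phi>) K_h2 (\<phi> (Par P_h2))"
  "frac_val (K_subst \<phi>) K_x (\<phi> Var_x)"
  "frac_val (K_subst \<phi>) K_y (\<phi> Var_y)"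
  using frac_val_K_gen[OF K_const.poly_eval_axioms] by (simp_all add: K_defs)

lemma var_cases_e:
  assumes "\<And>i. i \<in> {1..8} \<Longrightarrow> P (Par (e_par i))" "P (Par P_h1)" "P (Par P_h2)" "P Var_x" "P Var_y"
  shows "P v"
proof (cases v)
  case (Par p)
  then show ?thesis
    using assms(1)[of 1] assms(1)[of 2] assms(1)[of 3] assms(1)[of 4] assms(1)[of 5]
      assms(1)[of 6] assms(1)[of 7] assms(1)[of 8] assms(2,3)
    by (cases p) auto
qed (use assms in auto)

lemma range_1_8: "{1..8::nat} = {1, 2, 3, 4, 5, 6, 7, 8}"
  by auto

lemma s_images_0:
  "i \<in> {1..8} \<Longrightarrow> s_images 0 (Par (e_par i)) = K_e i"
  "s_images 0 (Par P_h1) = K_h2" "s_images 0 (Par P_h2) = K_h1"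
  "s_images 0 Var_x = 1 / K_y" "s_images 0 Var_y = 1 / K_x"
  unfolding range_1_8 by (auto simp: s_images_def K_defs)

lemma s_images_4:
  "i \<in> {1..8} \<Longrightarrow> s_images 4 (Par (e_par i))
     = (if i = 4 then K_h2 / K_e 5 else if i = 5 then K_h2 / K_e 4 else K_e i)"
  "s_images 4 (Par P_h1) = K_h1 * K_h2 / (K_e 4 * K_e 5)" "s_images 4 (Par P_h2) = K_h2"
  "s_images 4 Var_x = s4_x" "s_images 4 Var_y = K_y"
  unfolding range_1_8 by (auto simp: s_images_def K_defs)

lemma s_images_0_val: "frac_val (K_subst (s_images 0)) (s_images 0 v) (K_gen v)"
proof -
  interpret h: frac_hom "K_subst (s_images 0)"
    by (rule frac_hom_K_eval)
  note vals = K_subst_gens[of "s_images 0", unfolded s_images_0]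
  have inv: "frac_val (K_subst (s_images 0)) (1 / K_y) K_x" "frac_val (K_subst (s_images 0)) (1 / K_x) K_y"
    using h.frac_val_divide[OF h.frac_val_1 vals(5)] h.frac_val_divide[OF h.frac_val_1 vals(6)]
    by simp_all
  show ?thesis
  proof (rule var_cases_e[of _ v])
    fix i :: nat assume "i \<in> {1..8}"
    from s_images_0(1)[OF this]
    show "frac_val (K_subst (s_images 0)) (s_images 0 (Par (e_par i))) (K_gen (Par (e_par i)))"
      using K_subst_gens(2)[of "s_images 0" i] by (simp flip: K_e_def)
  qed (use vals inv in \<open>simp_all add: s_images_0 flip: K_defs\<close>)
qed

lemma s_images_4_val: "frac_val (K_subst (s_images 4)) (s_images 4 v) (K_gen v)"
proof -
  interpret h: frac_hom "K_subst (s_images 4)"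
    by (rule frac_hom_K_eval)
  have gens: "frac_val (K_subst (s_images 4)) (K_e 4) (K_h2 / K_e 5)"
    "frac_val (K_subst (s_images 4)) (K_e 5) (K_h2 / K_e 4)"
    "frac_val (K_subst (s_images 4)) K_h1 (K_h1 * K_h2 / (K_e 4 * K_e 5))"
    "frac_val (K_subst (s_images 4)) K_h2 K_h2"
    "frac_val (K_subst (s_images 4)) K_x s4_x"
    "frac_val (K_subst (s_images 4)) K_y K_y"
    using K_subst_gens(2)[of "s_images 4" 4] K_subst_gens(2)[of "s_images 4" 5]
      K_subst_gens(3-6)[of "s_images 4"] s_images_4(1)[of 4] s_images_4(1)[of 5]
    by (simp_all add: s_images_4(2-))
  have "frac_val (K_subst (s_images 4))
      (s4_num (K_e 4) (K_e 5) K_h1 K_h2 K_x K_y / s4_den (K_e 4) (K_e 5) K_h1 K_h2 K_x K_y)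
      (s4_num (K_h2 / K_e 5) (K_h2 / K_e 4) (K_h1 * K_h2 / (K_e 4 * K_e 5)) K_h2 s4_x K_y
       / s4_den (K_h2 / K_e 5) (K_h2 / K_e 4) (K_h1 * K_h2 / (K_e 4 * K_e 5)) K_h2 s4_x K_y)"
    by (rule h.frac_val_divide[OF _ _ s4_den_twice_nonzero])
      (unfold s4_num_def s4_den_def, (rule h.frac_val_intros gens)+)
  then have x: "frac_val (K_subst (s_images 4)) s4_x K_x"
    using s4_involution[OF _ _ _ s4_x_eq s4_den_nonzero s4_den_twice_nonzero]
    by (simp flip: s4_x_eq)
  have e4: "frac_val (K_subst (s_images 4)) (K_h2 / K_e 5) (K_e 4)"
    and e5: "frac_val (K_subst (s_images 4)) (K_h2 / K_e 4) (K_e 5)"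
    using h.frac_val_divide[OF gens(4,2)] h.frac_val_divide[OF gens(4,1)] by simp_all
  have h1: "frac_val (K_subst (s_images 4)) (K_h1 * K_h2 / (K_e 4 * K_e 5)) K_h1"
    using h.frac_val_divide[OF h.frac_val_mult[OF gens(3,4)] h.frac_val_mult[OF gens(1,2)]] by simp
  show ?thesis
  proof (rule var_cases_e[of _ v])
    fix i :: nat assume "i \<in> {1..8}"
    then show "frac_val (K_subst (s_images 4)) (s_images 4 (Par (e_par i))) (K_gen (Par (e_par i)))"
      using K_subst_gens(2)[of "s_images 4" i] e4 e5 by (auto simp: s_images_4 simp flip: K_e_def)
  qed (simp_all add: s_images_4 h1 gens x flip: K_defs)
qed

lemma transpose_Suc_range: "j \<in> {1..7} \<Longrightarrow> i \<in> {1..8} \<Longrightarrow> transpose j (Suc j) i \<in> {1..8}"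
  by (auto simp: transpose_def)

lemma s_images_transposition:
  assumes "j \<in> {1, 2, 3, 5, 6, 7}"
  shows "i \<in> {1..8} \<Longrightarrow> s_images j (Par (e_par i)) = K_e (transpose j (Suc j) i)"
    "s_images j (Par P_h1) = K_h1" "s_images j (Par P_h2) = K_h2"
    "s_images j Var_x = K_x" "s_images j Var_y = K_y"
proof -
  assume "i \<in> {1..8}"
  then have "i \<in> {1, 2, 3, 4, 5, 6, 7, 8}"
    by (simp only: range_1_8)
  with assms show "s_images j (Par (e_par i)) = K_e (transpose j (Suc j) i)"
    by (elim insertE emptyE; simp add: s_images_def K_e_def transpose_def)
next
  show "s_images j (Par P_h1) = K_h1" "s_images j (Par P_h2) = K_h2"
    "s_images j Var_x = K_x" "s_images j Var_y = K_y"
    using assms by (elim insertE emptyE; simp add: s_images_def K_defs)+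
qed

lemma s_images_transposition_val:
  assumes j: "j \<in> {1, 2, 3, 5, 6, 7}"
  shows "frac_val (K_subst (s_images j)) (s_images j v) (K_gen v)"
proof (rule var_cases_e[of _ v])
  fix i :: nat assume i: "i \<in> {1..8}"
  then have tr: "transpose j (Suc j) i \<in> {1..8}"
    using j by (intro transpose_Suc_range) auto
  then show "frac_val (K_subst (s_images j)) (s_images j (Par (e_par i))) (K_gen (Par (e_par i)))"
    using K_subst_gens(2)[of "s_images j" "transpose j (Suc j) i"]
    by (simp add: s_images_transposition(1)[OF j i] s_images_transposition(1)[OF j tr]
        flip: K_e_def del: atLeastAtMost_iff)
qed (use s_images_transposition[OF j] K_subst_gens(3-6)[of "s_images j"] in \<open>simp_all flip: K_defs\<close>)

lemma s_images_val: "j \<le> 7 \<Longrightarrow> frac_val (K_subst (s_images j)) (s_images j v) (K_gen v)"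
proof -
  assume "j \<le> 7"
  then have "j = 0 \<or> j = 4 \<or> j \<in> {1, 2, 3, 5, 6, 7}"
    by auto
  then show ?thesis
    using s_images_0_val s_images_4_val s_images_transposition_val by metis
qed

lemma
  assumes "j \<le> 7"
  shows s_C_automorphism: "C_automorphism (s j)"
    and s_gen: "s j (K_gen v) = s_images j v"
    and s_s [simp]: "s j (s j F) = F"
  unfolding s_def using aut_of_involution[OF s_images_val[OF assms]] by auto

lemma field_hom_s: "j \<le> 7 \<Longrightarrow> field_hom (s j)"
  using s_C_automorphism by (simp add: C_automorphism_def field_automorphismD)

section \<open>The translation\<close>

lemma
  assumes "j \<le> 7"
  shows s_add: "s j (a + b) = s j a + s j b" and s_diff: "s j (a - b) = s j a - s j b"
    and s_mult: "s j (a * b) = s j a * s j b" and s_divide: "s j (a / b) = s j a / s j b"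
    and s_one: "s j 1 = 1" and s_power: "s j (a ^ n) = s j a ^ n"
    and s_prod: "s j (prod f S) = (\<Prod>i\<in>S. s j (f i))"
proof -
  interpret field_hom "s j"
    using assms by (rule field_hom_s)
  show "s j (a + b) = s j a + s j b" "s j (a - b) = s j a - s j b" "s j (a * b) = s j a * s j b"
    "s j (a / b) = s j a / s j b" "s j 1 = 1" "s j (a ^ n) = s j a ^ n"
    "s j (prod f S) = (\<Prod>i\<in>S. s j (f i))"
    by (simp_all add: hom_add hom_diff hom_mult hom_divide hom_one hom_power hom_prod)
qed

lemmas s_hom = s_add s_diff s_mult s_divide s_one s_power s_prod

lemma s_0_gens:
  "i \<in> {1..8} \<Longrightarrow> s 0 (K_e i) = K_e i" "s 0 K_h1 = K_h2" "s 0 K_h2 = K_h1"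
  "s 0 K_x = 1 / K_y" "s 0 K_y = 1 / K_x"
  using s_images_0 by (simp_all add: K_defs s_gen)

lemma s_4_gens:
  "i \<in> {1..8} \<Longrightarrow> s 4 (K_e i) = (if i = 4 then K_h2 / K_e 5 else if i = 5 then K_h2 / K_e 4 else K_e i)"
  "s 4 K_h1 = K_h1 * K_h2 / (K_e 4 * K_e 5)" "s 4 K_h2 = K_h2"
  "s 4 K_x = s4_x" "s 4 K_y = K_y"
  using s_images_4 by (simp_all add: K_defs s_gen)

lemma s_transposition_gens:
  assumes "j \<in> {1, 2, 3, 5, 6, 7}"
  shows "i \<in> {1..8} \<Longrightarrow> s j (K_e i) = K_e (transpose j (Suc j) i)"
    "s j K_h1 = K_h1" "s j K_h2 = K_h2" "s j K_x = K_x" "s j K_y = K_y"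
proof -
  have "j \<le> 7"
    using assms by auto
  then show "i \<in> {1..8} \<Longrightarrow> s j (K_e i) = K_e (transpose j (Suc j) i)"
    "s j K_h1 = K_h1" "s j K_h2 = K_h2" "s j K_x = K_x" "s j K_y = K_y"
    using s_images_transposition[OF assms] by (simp_all add: K_defs s_gen)
qed

lemma range_1_7_cases: "j \<in> {1..7::nat} \<Longrightarrow> j = 4 \<or> j \<in> {1, 2, 3, 5, 6, 7}"
  by auto

lemma s_h2_y: "j \<in> {1..7} \<Longrightarrow> s j K_h2 = K_h2" "j \<in> {1..7} \<Longrightarrow> s j K_y = K_y"
  using range_1_7_cases s_transposition_gens(3,5) s_4_gens(3,5) by metis+

section \<open>Quantities permuted or fixed by the reflections\<close>

definition K_a :: "nat \<Rightarrow> K" where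
  "K_a i = (if i \<le> 4 then K_e i else K_h2 / K_e i)"

lemma s_a:
  assumes "j \<in> {1..7}" "i \<in> {1..8}"
  shows "s j (K_a i) = K_a (transpose j (Suc j) i)"
  using range_1_7_cases[OF assms(1)]
proof
  assume "j = 4"
  then show ?thesis
    using assms(2) by (auto simp: K_a_def s_4_gens s_hom transpose_def)
next
  assume j: "j \<in> {1, 2, 3, 5, 6, 7}"
  then have "transpose j (Suc j) i \<le> 4 \<longleftrightarrow> i \<le> 4"
    by (auto simp: transpose_def)
  then show ?thesis
    using assms j by (auto simp: K_a_def s_transposition_gens[OF j] s_hom)
qed

lemma prod_1_4: "(\<Prod>i=1..4. f i) = f 1 * f 2 * f 3 * (f (4::nat) :: 'a::comm_monoid_mult)"
proof -
  have "{1..4::nat} = {1, 2, 3, 4}"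
    by auto
  then show ?thesis
    by (simp add: mult.assoc)
qed

lemma prod_5_8: "(\<Prod>i=5..8. f i) = f 5 * f 6 * f 7 * (f (8::nat) :: 'a::comm_monoid_mult)"
proof -
  have "{5..8::nat} = {5, 6, 7, 8}"
    by auto
  then show ?thesis
    by (simp add: mult.assoc)
qed

lemma prod_1_8_split: "(\<Prod>i=1..8. f i) = (\<Prod>i=1..4. f i) * (\<Prod>i=5..8. f (i::nat) :: 'a::comm_monoid_mult)"
proof -
  have "{1..8::nat} = {1..4} \<union> {5..8}"
    by auto
  then show ?thesis
    by (simp add: prod.union_disjoint)
qed

lemmas prods = prod_1_4 prod_1_4[unfolded One_nat_def] prod_5_8 prod_1_8_split prod_1_8_split[unfolded One_nat_def]

definition K_Z :: K where
  "K_Z = (K_x * K_y - K_h1 / K_h2) / (K_x * K_y - 1)"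

definition K_Z_inv :: K where
  "K_Z_inv = K_Z * (\<Prod>i=5..8. K_y - K_a i / K_h2)"

definition K_h_inv :: K where
  "K_h_inv = K_h1 * (\<Prod>i=5..8. K_a i)"

text \<open>As functions of \<open>x\<close> with \<open>y\<close> fixed, \<open>K_Z\<close> and its
  image under \<open>s 4\<close> have the same zero and the same pole, so their ratio is free of
  \<open>x\<close>.\<close>

lemma Z_s4_field:
  fixes x y :: "'a::field"
  assumes "e4 \<noteq> 0" "e5 \<noteq> 0" "h2 \<noteq> 0" "x * y \<noteq> 1"
    and "X * s4_den e4 e5 h1 h2 x y = s4_num e4 e5 h1 h2 x y"
    and "s4_den e4 e5 h1 h2 x y \<noteq> 0" "X * y \<noteq> 1"
  shows "(X * y - h1 * h2 / (e4 * e5) / h2) / (X * y - 1) * (y - e4 / h2)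
       = (x * y - h1 / h2) / (x * y - 1) * (y - 1 / e5)"
proof -
  define D where "D = s4_den e4 e5 h1 h2 x y"
  \<comment> \<open>Both sides are linear in \<open>X\<close>, so a single factor \<open>D\<close>
    suffices to eliminate \<open>X\<close> by means of its defining relation.\<close>
  have "(X * y * (e4 * e5) - h1) * (h2 * y - e4) * ((x * y - 1) * h2) * D
      = (x * y * h2 - h1) * (e5 * y - 1) * ((X * y - 1) * (h2 * e4)) * D"
    using assms(5) unfolding D_def s4_den_def s4_num_def by algebra
  then have *: "(X * y * (e4 * e5) - h1) * (h2 * y - e4) * ((x * y - 1) * h2)
      = (x * y * h2 - h1) * (e5 * y - 1) * ((X * y - 1) * (h2 * e4))"
    using assms(6) by (simp add: D_def)
  have "(X * y - h1 * h2 / (e4 * e5) / h2) / (X * y - 1) * (y - e4 / h2)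
      = (X * y * (e4 * e5) - h1) * (h2 * y - e4) / ((X * y - 1) * (e4 * e5 * h2))"
    using assms by (simp add: divide_simps)
  moreover have "(x * y - h1 / h2) / (x * y - 1) * (y - 1 / e5)
      = (x * y * h2 - h1) * (e5 * y - 1) / ((x * y - 1) * (e5 * h2))"
    using assms by (simp add: divide_simps)
  ultimately show ?thesis
    using * assms by (simp add: frac_eq_eq) algebra
qed

lemma sample_nonzero: "frac_val (cpoly_eval (\<lambda>a. a) sample_point) F z \<and> z \<noteq> 0 \<Longrightarrow> F \<noteq> 0"
  using sample.frac_val_nonzero by blast

lemma K_xy_nonzero: "K_x * K_y - 1 \<noteq> 0" "K_x * K_y - K_h1 / K_h2 \<noteq> 0"
  by (rule sample_nonzero, ((rule conjI sample_intros | simp)+)[1])+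

lemma K_y_a_nonzero:
  assumes "i \<in> {1..8}"
  shows "K_y - K_a i / K_h2 \<noteq> 0"
proof (cases "i \<le> 4")
  case True
  have "K_y - K_e i / K_h2 \<noteq> 0"
    using assms True unfolding range_1_8
    by (elim insertE emptyE; (simp only:)?)
      (rule sample_nonzero, ((rule conjI sample_intros | simp)+)[1])+
  with True show ?thesis
    by (simp add: K_a_def)
next
  case False
  have "K_y - 1 / K_e i \<noteq> 0"
    using assms False unfolding range_1_8
    by (elim insertE emptyE; (simp only:)?)
      (rule sample_nonzero, ((rule conjI sample_intros | simp)+)[1])+
  with False show ?thesis
    by (simp add: K_a_def)
qed

lemma s4_Z: "s 4 K_Z * (K_y - K_a 4 / K_h2) = K_Z * (K_y - K_a 5 / K_h2)"
proof -
  have "s 4 (K_x * K_y - 1) \<noteq> 0"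
    using field_hom.hom_eq_0_iff[OF field_hom_s[of 4]] K_xy_nonzero by simp
  then have "s4_x * K_y \<noteq> 1"
    by (simp add: s_hom s_4_gens)
  moreover have "s4_x * s4_den (K_e 4) (K_e 5) K_h1 K_h2 K_x K_y = s4_num (K_e 4) (K_e 5) K_h1 K_h2 K_x K_y"
    by (simp add: s4_x_eq s4_den_nonzero)
  ultimately show ?thesis
    using Z_s4_field[of "K_e 4" "K_e 5" K_h2 K_x K_y s4_x K_h1] K_xy_nonzero s4_den_nonzero
    by (simp add: K_Z_def K_a_def s_hom s_4_gens)
qed

text \<open>For \<open>j = 4\<close> the transposition replaces \<open>K_a 5\<close> by
  \<open>K_a 4\<close> in the product, which the factor acquired by \<open>K_Z\<close> compensates.
  Any other \<open>j\<close> fixes \<open>K_Z\<close> and maps the indices 5, 6, 7, 8 among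
  themselves.\<close>

lemma s_Z_inv:
  assumes "j \<in> {1..7}"
  shows "s j K_Z_inv = K_Z_inv"
proof -
  have j: "j \<le> 7"
    using assms by simp
  have "s j K_Z_inv = s j K_Z * (\<Prod>i=5..8. K_y - K_a (transpose j (Suc j) i) / K_h2)"
    using assms by (simp add: K_Z_inv_def s_hom[OF j] s_h2_y s_a)
  also have "\<dots> = K_Z_inv"
    using range_1_7_cases[OF assms]
  proof
    assume "j = 4"
    then show ?thesis
      using s4_Z by (simp add: K_Z_inv_def prod_5_8 transpose_def mult.assoc)
  next
    assume j': "j \<in> {1, 2, 3, 5, 6, 7}"
    have "s j K_Z = K_Z"
      by (simp add: K_Z_def s_hom[OF j] s_transposition_gens[OF j'])
    then show ?thesis
      using j' by (elim insertE emptyE; simp add: K_Z_inv_def prod_5_8 transpose_def mult_ac)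
  qed
  finally show ?thesis .
qed

text \<open>For \<open>j = 4\<close>, h1 is multiplied by h2 / (e4 e5) = a5 / a4, while a5 turns
  into a4.\<close>

lemma s_h_inv:
  assumes "j \<in> {1..7}"
  shows "s j K_h_inv = K_h_inv"
proof -
  have j: "j \<le> 7"
    using assms by simp
  have "s j K_h_inv = s j K_h1 * (\<Prod>i=5..8. K_a (transpose j (Suc j) i))"
    using assms by (simp add: K_h_inv_def s_hom[OF j] s_a)
  also have "\<dots> = K_h_inv"
    using range_1_7_cases[OF assms]
  proof
    assume "j = 4"
    then show ?thesis
      by (simp add: K_h_inv_def K_a_def s_4_gens prod_5_8 transpose_def mult.assoc)
  next
    assume j': "j \<in> {1, 2, 3, 5, 6, 7}"
    then show ?thesis
      using s_transposition_gens(2)[OF j']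
      by (elim insertE emptyE; simp add: K_h_inv_def prod_5_8 transpose_def mult_ac)
  qed
  finally show ?thesis .
qed

section \<open>Words in the reflections\<close>

definition s_word :: "nat list \<Rightarrow> K \<Rightarrow> K" where
  "s_word js = foldr (\<circ>) (map s js) id"

lemma s_word_Nil [simp]: "s_word [] F = F"
  and s_word_Cons [simp]: "s_word (j # js) F = s j (s_word js F)"
  by (simp_all add: s_word_def)

lemma s_word_append: "s_word (js @ ks) F = s_word js (s_word ks F)"
  by (induction js) simp_all

lemma s_word_rev:
  assumes "set js \<subseteq> {1..7}"
  shows "s_word (rev js) (s_word js F) = F"
  using assms by (induction js) (auto simp: s_word_append)

lemma field_hom_s_word: "set js \<subseteq> {1..7} \<Longrightarrow> field_hom (s_word js)"
proof (induction js)
  case (Cons j js)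
  interpret w: field_hom "s_word js"
    using Cons by simp
  interpret sj: field_hom "s j"
    using Cons.prems by (intro field_hom_s) auto
  show ?case
    by unfold_locales (simp_all add: w.hom_add w.hom_mult w.hom_one sj.hom_add sj.hom_mult sj.hom_one)
qed (unfold_locales, simp_all)

lemma s_word_fixed:
  assumes "set js \<subseteq> {1..7}"
  shows "s_word js K_h2 = K_h2" "s_word js K_y = K_y" "s_word js K_Z_inv = K_Z_inv"
    "s_word js K_h_inv = K_h_inv"
  using assms by (induction js) (simp_all add: s_h2_y s_Z_inv s_h_inv)

text \<open>Both folds apply the last letter first, so the words compose like the permutations of
  the indices. Membership in the range is carried along because \<open>s_a\<close> requires
  it.\<close>

lemma s_word_a:
  assumes "set js \<subseteq> {1..7}" "i \<in> {1..8}"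
  shows "foldr (\<lambda>j. transpose j (Suc j)) js i \<in> {1..8}
    \<and> s_word js (K_a i) = K_a (foldr (\<lambda>j. transpose j (Suc j)) js i)"
  using assms(1)
proof (induction js)
  case (Cons j js)
  then show ?case
    using s_a[of j] transpose_Suc_range[of j] by simp
qed (use assms(2) in simp)

text \<open>These conditions are all that is used of w. The exchange of the blocks is an involution,
  so the inverse of w satisfies them as well, and one computation serves both equations.\<close>

locale block_swap = field_hom \<sigma> for \<sigma> :: "K \<Rightarrow> K" +
  assumes fixed: "\<sigma> K_h2 = K_h2" "\<sigma> K_y = K_y" "\<sigma> K_Z_inv = K_Z_inv" "\<sigma> K_h_inv = K_h_inv"
    and swap: "i \<in> {1..8} \<Longrightarrow> \<sigma> (K_a i) = K_a (if i \<le> 4 then i + 4 else i - 4)"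
begin

text \<open>Invariance of \<open>K_h_inv\<close> gives \<sigma>(h1) a1 a2 a3 a4 = h1 a5 a6 a7 a8,
  and the quotient of the two products of the a_i is h2^4 / (e1 ... e8) = q h2^2 / h1^2.\<close>

lemma h1: "\<sigma> K_h1 = q_of K_e K_h1 K_h2 * K_h2 ^ 2 / K_h1"
proof -
  have "\<sigma> K_h1 * (K_e 1 * K_e 2 * K_e 3 * K_e 4)
      = K_h1 * (K_h2 / K_e 5 * (K_h2 / K_e 6) * (K_h2 / K_e 7) * (K_h2 / K_e 8))"
    using fixed(4) swap[of 5] swap[of 6] swap[of 7] swap[of 8]
    unfolding K_h_inv_def prod_5_8 hom_mult by (simp add: K_a_def mult.assoc)
  then show ?thesis
    by (simp add: q_of_def prods field_simps power2_eq_square)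
qed

lemma equation1: "xy_equation1 K_e K_h1 K_h2 K_x K_y (\<sigma> K_x)"
proof -
  define N where "N = (\<Prod>i=1..4. K_y - K_a i / K_h2)"
  define D where "D = (\<Prod>i=5..8. K_y - K_a i / K_h2)"
  have "\<sigma> D = N"
    using swap[of 5] swap[of 6] swap[of 7] swap[of 8]
    by (simp add: D_def N_def prods hom_mult hom_diff hom_divide fixed)
  have r: "\<sigma> K_h1 / K_h2 = q_of K_e K_h1 K_h2 * K_h2 / K_h1"
    by (simp add: h1 power2_eq_square)
  have "N \<noteq> 0" "D \<noteq> 0"
    using K_y_a_nonzero by (auto simp: N_def D_def)
  have "\<sigma> (K_x * K_y - 1) \<noteq> 0" "\<sigma> (K_x * K_y - K_h1 / K_h2) \<noteq> 0"
    by (simp_all only: hom_eq_0_iff K_xy_nonzero not_False_eq_True)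
  then have nz: "\<sigma> K_x * K_y - 1 \<noteq> 0" "\<sigma> K_x * K_y - q_of K_e K_h1 K_h2 * K_h2 / K_h1 \<noteq> 0"
    by (simp_all add: hom_diff hom_mult hom_divide hom_one fixed r)
  have "\<sigma> K_Z * N = K_Z * D"
    using fixed(3) \<open>\<sigma> D = N\<close> by (simp add: K_Z_inv_def hom_mult D_def)
  moreover have "\<sigma> K_Z = (\<sigma> K_x * K_y - q_of K_e K_h1 K_h2 * K_h2 / K_h1) / (\<sigma> K_x * K_y - 1)"
    by (simp add: K_Z_def hom_diff hom_mult hom_divide hom_one fixed r)
  ultimately have "(\<sigma> K_x * K_y - 1) / (\<sigma> K_x * K_y - q_of K_e K_h1 K_h2 * K_h2 / K_h1) * K_Z = N / D"
    using nz \<open>N \<noteq> 0\<close> \<open>D \<noteq> 0\<close> by (simp add: field_simps)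
  moreover have "N = (\<Prod>i=1..4. K_y - K_e i / K_h2)" "D = (\<Prod>i=5..8. K_y - 1 / K_e i)"
    by (simp_all add: N_def D_def K_a_def)
  ultimately show ?thesis
    by (simp add: xy_equation1_def K_Z_def)
qed

end

section \<open>The translation and its inverse\<close>

definition T_word :: "nat list" where
  "T_word = [4, 5, 6, 7, 3, 4, 5, 6, 2, 3, 4, 5, 1, 2, 3, 4]"

lemma T_word_range: "set T_word \<subseteq> {1..7}" "set (rev T_word) \<subseteq> {1..7}"
  by (simp_all add: T_word_def)

interpretation w: block_swap "s_word T_word"
proof (intro block_swap.intro block_swap_axioms.intro)
  show "s_word T_word (K_a i) = K_a (if i \<le> 4 then i + 4 else i - 4)" if "i \<in> {1..8}" for i
  proof -
    have "foldr (\<lambda>j. transpose j (Suc j)) T_word i = (if i \<le> 4 then i + 4 else i - 4)"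
      using that unfolding range_1_8
      by (elim insertE emptyE; simp add: T_word_def transpose_def)
    then show ?thesis
      using s_word_a[OF T_word_range(1) that] by simp
  qed
qed (rule field_hom_s_word s_word_fixed, rule T_word_range(1))+

interpretation w': block_swap "s_word (rev T_word)"
proof (intro block_swap.intro block_swap_axioms.intro)
  show "s_word (rev T_word) (K_a i) = K_a (if i \<le> 4 then i + 4 else i - 4)" if "i \<in> {1..8}" for i
  proof -
    have "foldr (\<lambda>j. transpose j (Suc j)) (rev T_word) i = (if i \<le> 4 then i + 4 else i - 4)"
      using that unfolding range_1_8
      by (elim insertE emptyE; simp add: T_word_def transpose_def)
    then show ?thesis
      using s_word_a[OF T_word_range(2) that] by simp
  qed
qed (rule field_hom_s_word s_word_fixed, rule T_word_range(2))+

lemma T_eq: "T F = s 0 (s_word T_word (s 0 (s_word T_word F)))"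
  by (simp add: T_def numeral_2_eq_2 T_word_def)

definition T_inv :: "K \<Rightarrow> K" where
  "T_inv F = s_word (rev T_word) (s 0 (s_word (rev T_word) (s 0 F)))"

lemma T_inv_T: "T_inv (T F) = F"
  using s_word_rev[OF T_word_range(1)] by (simp add: T_eq T_inv_def)

lemma T_T_inv: "T (T_inv F) = F"
  using s_word_rev[OF T_word_range(2)] by (simp add: T_eq T_inv_def)

lemma bij_T: "bij T"
  using T_inv_T T_T_inv by (metis bijI')

lemma inv_T: "inv T = T_inv"
  using T_inv_T T_T_inv bij_T by (metis bij_inv_eq_iff ext)

lemma field_hom_comp: "field_hom f \<Longrightarrow> field_hom g \<Longrightarrow> field_hom (\<lambda>a. f (g a))"
  unfolding field_hom_def comm_ring_hom_def by simp

lemma field_hom_T: "field_hom T"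
  using field_hom_comp[OF field_hom_s field_hom_comp[OF w.field_hom_axioms
    field_hom_comp[OF field_hom_s w.field_hom_axioms]]]
  by (simp add: T_eq[abs_def])

lemma field_hom_T_inv: "field_hom T_inv"
  using field_hom_comp[OF w'.field_hom_axioms field_hom_comp[OF field_hom_s
    field_hom_comp[OF w'.field_hom_axioms field_hom_s]]]
  by (simp add: T_inv_def[abs_def])

interpretation T: field_hom T by (rule field_hom_T)
interpretation T_inv: field_hom T_inv by (rule field_hom_T_inv)

lemma s_0_q: "s 0 (q_of K_e K_h1 K_h2) = q_of K_e K_h1 K_h2"
  by (simp add: q_of_def s_hom s_0_gens mult.commute)

lemma T_h2: "T K_h2 = q_of K_e K_h1 K_h2 * K_h1 ^ 2 / K_h2"
  by (simp add: T_eq w.fixed s_0_gens w.h1 s_hom s_0_q)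

lemma T_inv_h1: "T_inv K_h1 = q_of K_e K_h1 K_h2 * K_h2 ^ 2 / K_h1"
  by (simp add: T_inv_def w'.fixed s_0_gens w'.h1)

text \<open>The inner \<open>s 0\<close> sends x to 1/y, which the reversed word fixes, and the
  other \<open>s 0\<close> returns x. Only the outer reversed word acts on x itself.\<close>

lemma T_inv_x: "T_inv K_x = s_word (rev T_word) K_x"
  by (simp add: T_inv_def w'.fixed w'.hom_divide w'.hom_one s_0_gens s_hom)

text \<open>The inner word fixes y, and \<open>s 0\<close> then turns y into 1/x, so only the outer
  word moves its argument.\<close>

lemma T_y: "T K_y = 1 / s 0 (s_word T_word K_x)"
  by (simp add: T_eq w.fixed w.hom_divide w.hom_one s_0_gens s_hom)

text \<open>Corresponding factors differ by monomials that are the same in numerator and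
  denominator, so the quotients agree even where a denominator vanishes.\<close>

lemma xy_equation2_conv_xy_equation1:
  fixes x y Y :: "'a::field"
  assumes "x \<noteq> 0" "y \<noteq> 0" "Y \<noteq> 0" "h1 \<noteq> 0" "h2 \<noteq> 0" "\<And>i. e i \<noteq> 0"
  shows "xy_equation2 e h1 h2 x y Y \<longleftrightarrow> xy_equation1 e h2 h1 (1 / y) (1 / x) (1 / Y)"
proof -
  have q: "q_of e h2 h1 = q_of e h1 h2"
    by (simp add: q_of_def mult.commute)
  define s where "s = q_of e h1 h2 * h1 / h2"
  have 1: "(1 / Y * (1 / x) - 1) / (1 / Y * (1 / x) - s) = (x * Y - 1) / (s * x * Y - 1)"
  proof -
    have "1 / Y * (1 / x) - 1 = (x * Y - 1) / (- (x * Y))" "1 / Y * (1 / x) - s = (s * x * Y - 1) / (- (x * Y))"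
      using assms(1,3) by (simp_all add: field_simps)
    moreover have "a / (- (x * Y)) / (b / (- (x * Y))) = a / b" for a b
      using assms(1,3) by simp
    ultimately show ?thesis
      by (simp only:)
  qed
  have 2: "(1 / y * (1 / x) - h2 / h1) / (1 / y * (1 / x) - 1) = (h2 / h1 * x * y - 1) / (x * y - 1)"
  proof -
    have "1 / y * (1 / x) - h2 / h1 = (h2 / h1 * x * y - 1) / (- (x * y))" 
      "1 / y * (1 / x) - 1 = (x * y - 1) / (- (x * y))"
      using assms(1,2,4) by (simp_all add: field_simps)
    moreover have "a / (- (x * y)) / (b / (- (x * y))) = a / b" for a b
      using assms(1,2) by simp
    ultimately show ?thesis
      by (simp only:)
  qed
  have 3: "(\<Prod>i=1..4. 1 / x - e i / h1) / (\<Prod>i=5..8. 1 / x - 1 / e i)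
      = (\<Prod>i=1..4. e i * x / h1 - 1) / (\<Prod>i=5..8. x / e i - 1)"
  proof -
    have "1 / x - e i / h1 = (e i * x / h1 - 1) / (- x)" "1 / x - 1 / e i = (x / e i - 1) / (- x)" for i
      using assms(1,4,6) by (simp_all add: field_simps)
    then show ?thesis
      using assms(1) by (simp add: prods)
  qed
  show ?thesis
    unfolding xy_equation1_def xy_equation2_def q 3 2 1[unfolded s_def] ..
qed

lemma equation1_T: "xy_equation1 K_e K_h1 K_h2 K_x K_y (inv T K_x)"
  using w'.equation1 by (simp add: inv_T T_inv_x)

lemma equation2_T: "xy_equation2 K_e K_h1 K_h2 K_x K_y (T K_y)"
proof -
  let ?X = "s_word T_word K_x"
  \<comment> \<open>The instance for w and not for its inverse: by \<open>T_y\<close>, the image of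
    \<open>?X\<close> under \<open>s 0\<close> is \<open>1 / T K_y\<close>.\<close>
  have "s 0 ((?X * K_y - 1) / (?X * K_y - q_of K_e K_h1 K_h2 * K_h2 / K_h1)
        * ((K_x * K_y - K_h1 / K_h2) / (K_x * K_y - 1)))
      = s 0 ((\<Prod>i=1..4. K_y - K_e i / K_h2) / (\<Prod>i=5..8. K_y - 1 / K_e i))"
    using w.equation1 unfolding xy_equation1_def by simp
  then have "xy_equation1 K_e K_h2 K_h1 (1 / K_y) (1 / K_x) (s 0 ?X)"
    unfolding xy_equation1_def
    by (simp add: s_hom s_0_gens s_0_q q_of_def[of _ K_h2 K_h1] q_of_def[of _ K_h1 K_h2] mult.commute)
  moreover have "T K_y \<noteq> 0"
    by (simp add: T.hom_eq_0_iff)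
  ultimately show ?thesis
    by (simp add: xy_equation2_conv_xy_equation1 T_y)
qed

section \<open>The auxiliary variable\<close>

lemma L_of_to_fract: "L_of F = to_fract [:F:]"
  by (simp add: L_of_def to_fract_def)

lemma L_lambda_to_fract: "L_lambda = to_fract [:0, 1:]"
  by (simp add: L_lambda_def to_fract_def)

interpretation L_of: field_hom L_of
  by unfold_locales (simp_all add: L_of_to_fract pCons_one flip: to_fract_add to_fract_mult)

lemma L_lambda_nonzero [simp]: "L_lambda \<noteq> 0"
  by (simp add: L_lambda_to_fract)

lemma field_hom_L_eqI:
  assumes "field_hom \<sigma>" "field_hom \<tau>"
    and "\<And>F. \<sigma> (L_of F) = \<tau> (L_of F)" "\<sigma> L_lambda = \<tau> L_lambda"
  shows "\<sigma> = \<tau>"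
proof (rule field_hom_fract_eqI[OF assms(1,2)])
  interpret \<sigma>: field_hom \<sigma> by fact
  interpret \<tau>: field_hom \<tau> by fact
  show "\<sigma> (to_fract P) = \<tau> (to_fract P)" for P
  proof (induction P)
    case (pCons a P)
    have "pCons a P = [:a:] + [:0, 1:] * P"
      by simp
    then have "to_fract (pCons a P) = L_of a + L_lambda * to_fract P"
      by (simp only: L_of_to_fract L_lambda_to_fract to_fract_add to_fract_mult)
    then show ?case
      using pCons.IH assms(3,4)
      by (simp add: \<sigma>.hom_add \<sigma>.hom_mult \<tau>.hom_add \<tau>.hom_mult)
  qed (simp add: \<sigma>.hom_zero \<tau>.hom_zero)
qed

text \<open>On polynomials the map applies \<tau> to the coefficients and replaces \<lambda> by c
  \<lambda>. It is injective because \<tau> is and \<open>c\<close> is nonzero, so it extends to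
  fractions.\<close>

lemma extend_to_L:
  assumes "field_hom \<tau>" "c \<noteq> 0"
  obtains \<sigma> where "field_hom \<sigma>" "\<And>F. \<sigma> (L_of F) = L_of (\<tau> F)" "\<sigma> L_lambda = L_lambda * L_of c"
proof -
  interpret \<tau>: field_hom \<tau> by fact
  define h :: "K poly \<Rightarrow> L" where "h P = to_fract (pcompose (map_poly \<tau> P) [:0, c:])" for P
  have add: "map_poly \<tau> (P + Q) = map_poly \<tau> P + map_poly \<tau> Q" for P Q
    by (rule poly_eqI) (simp add: coeff_map_poly \<tau>.hom_zero \<tau>.hom_add)
  have mult: "map_poly \<tau> (P * Q) = map_poly \<tau> P * map_poly \<tau> Q" for P Q
    by (rule poly_eqI) (simp add: coeff_map_poly \<tau>.hom_zero coeff_mult \<tau>.hom_sum \<tau>.hom_mult)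
  interpret h: frac_hom h
    by unfold_locales
      (simp_all add: h_def add mult pcompose_add pcompose_mult \<tau>.hom_one map_poly_1 pcompose_1 pCons_one)
  have "P = 0" if "h P = 0" for P
  proof -
    have "map_poly \<tau> P = 0"
      using that assms(2) by (simp add: h_def pcompose_eq_0_iff)
    then show ?thesis
      by (simp add: map_poly_eq_0_iff \<tau>.hom_zero \<tau>.hom_eq_0_iff)
  qed
  then obtain \<sigma> where \<sigma>: "field_hom \<sigma>" "\<And>P. \<sigma> (to_fract P) = h P"
    using h.injective_extends by blast
  have "\<sigma> (L_of F) = L_of (\<tau> F)" for F
    by (simp add: \<sigma>(2) L_of_to_fract h_def map_poly_pCons \<tau>.hom_zero)
  moreover have "\<sigma> L_lambda = L_lambda * L_of c"
    by (simp add: \<sigma>(2) L_of_to_fract L_lambda_to_fract h_def map_poly_pCons \<tau>.hom_zero \<tau>.hom_one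
        pcompose_pCons flip: to_fract_mult)
  ultimately show thesis
    using that \<sigma>(1) by blast
qed

abbreviation K_q :: K where
  "K_q \<equiv> q_of K_e K_h1 K_h2"

lemma K_q_nonzero: "K_q \<noteq> 0"
  by (simp add: q_of_def)

lemma
  shows field_automorphism_T_L: "field_automorphism T_L"
    and T_L_L_of: "T_L (L_of F) = L_of (T F)"
    and T_L_lambda: "T_L L_lambda = L_lambda * L_of (K_q * K_h1 / K_h2)"
proof -
  define c where "c = K_q * K_h1 / K_h2"
  have c: "c \<noteq> 0"
    by (simp add: c_def K_q_nonzero)
  have c_eq: "L_lambda * L_of (T K_h2) / L_of K_h1 = L_lambda * L_of c"
  proof -
    have "T K_h2 / K_h1 = c"
      by (simp add: c_def T_h2 power2_eq_square)
    then show ?thesis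
      by (metis L_of.hom_divide times_divide_eq_right)
  qed
  have T_inv_c: "1 / T_inv c \<noteq> 0"
    using c by (simp add: T_inv.hom_eq_0_iff)
  obtain \<sigma> where \<sigma>: "field_hom \<sigma>" "\<And>F. \<sigma> (L_of F) = L_of (T F)" "\<sigma> L_lambda = L_lambda * L_of c"
    using extend_to_L[OF field_hom_T c] by blast
  \<comment> \<open>The inverse must divide \<lambda> by \<open>T_inv c\<close>: applying
    \<open>T\<close> to this factor gives back \<open>c\<close>, which cancels the factor that
    \<lambda> acquires under \<sigma>.\<close>
  obtain \<sigma>' where \<sigma>': "field_hom \<sigma>'" "\<And>F. \<sigma>' (L_of F) = L_of (T_inv F)"
      "\<sigma>' L_lambda = L_lambda * L_of (1 / T_inv c)"
    using extend_to_L[OF field_hom_T_inv T_inv_c] by blast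
  interpret \<sigma>: field_hom \<sigma> by fact
  interpret \<sigma>': field_hom \<sigma>' by fact
  have id: "field_hom (\<lambda>a::L. a)"
    by unfold_locales simp_all
  have "(\<lambda>a. \<sigma> (\<sigma>' a)) = (\<lambda>a. a)"
    using \<sigma>' \<sigma> c
    by (intro field_hom_L_eqI[OF field_hom_comp[OF \<sigma>(1) \<sigma>'(1)] id])
      (simp_all add: \<sigma>.hom_mult \<sigma>.hom_divide T_T_inv T.hom_divide T.hom_one L_of.hom_divide L_of.hom_one L_of.hom_eq_0_iff)
  moreover have "(\<lambda>a. \<sigma>' (\<sigma> a)) = (\<lambda>a. a)"
    using \<sigma>' \<sigma> c
    by (intro field_hom_L_eqI[OF field_hom_comp[OF \<sigma>'(1) \<sigma>(1)] id])
      (simp_all add: \<sigma>'.hom_mult T_inv_T L_of.hom_divide L_of.hom_one L_of.hom_eq_0_iff T_inv.hom_eq_0_iff)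
  ultimately have "bij \<sigma>"
    by (metis bijI')
  then have aut: "field_automorphism \<sigma>"
    by (simp add: field_automorphismI \<sigma>(1))
  have "T_L = \<sigma>"
    unfolding T_L_def
  proof (rule the_equality)
    show "field_automorphism \<sigma> \<and> (\<forall>F. \<sigma> (L_of F) = L_of (T F))
        \<and> \<sigma> L_lambda = L_lambda * L_of (T K_h2) / L_of K_h1"
      using aut \<sigma>(2,3) c_eq by simp
    show "\<tau> = \<sigma>" if "field_automorphism \<tau> \<and> (\<forall>F. \<tau> (L_of F) = L_of (T F))
        \<and> \<tau> L_lambda = L_lambda * L_of (T K_h2) / L_of K_h1" for \<tau>
      using that \<sigma>(2,3) c_eq by (intro field_hom_L_eqI \<sigma>(1)) (auto dest: field_automorphismD)
  qed
  with aut \<sigma>(2,3) show "field_automorphism T_L" "T_L (L_of F) = L_of (T F)"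
    "T_L L_lambda = L_lambda * L_of (K_q * K_h1 / K_h2)"
    by (simp_all add: c_def)
qed

interpretation T_L: field_hom T_L
  by (rule field_automorphismD(1)[OF field_automorphism_T_L])

lemma bij_T_L: "bij T_L"
  by (rule field_automorphismD(2)[OF field_automorphism_T_L])

lemma inv_T_L_eqI: "T_L a = b \<Longrightarrow> inv T_L b = a"
  using bij_T_L by (auto simp: bij_def)

text \<open>The value is \<lambda> T^(-1)(h1) / h2, because T maps T^(-1)(h1) / h2 to h1 / T(h2),
  the reciprocal of the factor in T(\<lambda>).\<close>

lemma inv_T_L_lambda: "inv T_L L_lambda = L_lambda * L_of (K_q * K_h2 / K_h1)"
proof (rule inv_T_L_eqI)
  have "T (T_inv K_h1 / K_h2) = K_h1 / T K_h2"
    by (simp add: T.hom_divide T_T_inv)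
  moreover have "T_inv K_h1 / K_h2 = K_q * K_h2 / K_h1"
    by (simp add: T_inv_h1 power2_eq_square)
  ultimately have "T (K_q * K_h2 / K_h1) = 1 / (K_q * K_h1 / K_h2)"
    by (simp add: T_h2 power2_eq_square)
  then have "T_L (L_lambda * L_of (K_q * K_h2 / K_h1))
      = L_lambda * (L_of (K_q * K_h1 / K_h2) * (1 / L_of (K_q * K_h1 / K_h2)))"
    by (simp only: T_L.hom_mult[of L_lambda] T_L_L_of T_L_lambda L_of.hom_divide[of 1] L_of.hom_one mult.assoc)
  moreover have "L_of (K_q * K_h1 / K_h2) \<noteq> 0"
    by (simp add: L_of.hom_eq_0_iff K_q_nonzero)
  ultimately show "T_L (L_lambda * L_of (K_q * K_h2 / K_h1)) = L_lambda"
    by simp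
qed

section \<open>Equivalence with the $q$-$E_7^{(1)}$ equation\<close>

lemma divide_cancel_factor: "a \<noteq> (0::'a::field) \<Longrightarrow> a * b / (a * c) = b / c"
  by simp

text \<open>The factor \<open>l * (q * h2 / h1)\<close> is the value of T^(-1)(\<lambda>). Each side
  of one equation is the same nonzero constant times the corresponding side of the other. Only
  nonzero quantities are cancelled, so the equivalence includes degenerate cases in which a
  denominator is 0.\<close>

lemma qE7_equation1_iff:
  fixes l :: "'a::field"
  assumes nz: "l \<noteq> 0" "h1 \<noteq> 0" "h2 \<noteq> 0" "\<And>i. e i \<noteq> 0" "x \<noteq> 0" "y \<noteq> 0" "X \<noteq> 0"
  defines "q \<equiv> q_of e h1 h2"
  shows "qE7_equation1 (\<lambda>i. e i / l) (h2 / l\<^sup>2) (h1 / l\<^sup>2) q (f_of l y) (g_of l x)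
           (g_of (l * (q * h2 / h1)) X) \<longleftrightarrow> xy_equation1 e h1 h2 x y X"
proof -
  have q0: "q \<noteq> 0"
    using nz by (simp add: q_def q_of_def)
  \<comment> \<open>The common constant, in the form in which the left-hand side produces it. By the
    definition of \<open>q\<close> it is h2^4 divided by the product of the e_i, which is what the
    right-hand side produces.\<close>
  define c where "c = q * h2\<^sup>2 / h1\<^sup>2"
  have c0: "c \<noteq> 0"
    using nz q0 by (simp add: c_def)
  let ?f = "f_of l y" and ?g = "g_of l x" and ?G = "g_of (l * (q * h2 / h1)) X"
  have k: "h2 / l\<^sup>2 / (h1 / l\<^sup>2) = h2 / h1" "q * (h2 / l\<^sup>2) / (h1 / l\<^sup>2) = q * (h2 / h1)"
    using nz by simp_all
  have n1: "?f * ?g - h2 / h1 = - (h2 / h1) / (x * y) * (x * y - h1 / h2)"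
    and n2: "?f * ?G - q * (h2 / h1) = - (q * (h2 / h1)) / (X * y) * (X * y - 1)"
    and d1: "?f * ?g - 1 = - 1 / (x * y) * (x * y - 1)"
    and d2: "?f * ?G - 1 = - 1 / (X * y) * (X * y - q * h2 / h1)"
    using nz by (simp_all add: f_of_def g_of_def field_simps)
  have "(?f * ?g - h2 / h1) * (?f * ?G - q * (h2 / h1)) / ((?f * ?g - 1) * (?f * ?G - 1))
      = (1 / (x * y * (X * y))) * (c * ((X * y - 1) * (x * y - h1 / h2)))
        / ((1 / (x * y * (X * y))) * ((X * y - q * h2 / h1) * (x * y - 1)))"
    unfolding n1 n2 d1 d2 by (simp add: c_def power2_eq_square mult_ac)
  also have "\<dots> = c * ((X * y - 1) * (x * y - h1 / h2)) / ((X * y - q * h2 / h1) * (x * y - 1))"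
    by (rule divide_cancel_factor) (use nz in simp)
  finally have lhs: "(?f * ?g - h2 / h1) * (?f * ?G - q * (h2 / h1)) / ((?f * ?g - 1) * (?f * ?G - 1))
      = c * ((X * y - 1) / (X * y - q * h2 / h1) * ((x * y - h1 / h2) / (x * y - 1)))"
    by simp
  have p1: "?f - h2 / l\<^sup>2 / (e i / l) = - h2 / (l * y * e i) * (y - e i / h2)"
    and p2: "?f - e i / l = - e i / (l * y) * (y - 1 / e i)" for i
    using nz by (simp_all add: f_of_def field_simps power2_eq_square)
  define E1 where "E1 = (\<Prod>i=1..4. e i)"
  define E2 where "E2 = (\<Prod>i=5..8. e i)"
  have E: "E1 \<noteq> 0" "E2 \<noteq> 0"
    using nz by (simp_all add: E1_def E2_def)
  have c_E: "c = h2 ^ 4 / (E1 * E2)"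
    using nz by (simp add: c_def q_def q_of_def prods E1_def E2_def field_simps eval_nat_numeral)
  have "(\<Prod>i=1..4. ?f - h2 / l\<^sup>2 / (e i / l)) / (\<Prod>i=5..8. ?f - e i / l)
      = (1 / (l * y) ^ 4) * (h2 ^ 4 / E1 * (\<Prod>i=1..4. y - e i / h2))
        / ((1 / (l * y) ^ 4) * (E2 * (\<Prod>i=5..8. y - 1 / e i)))"
    unfolding p1 p2 E1_def E2_def prods by (simp add: eval_nat_numeral mult_ac)
  also have "\<dots> = (h2 ^ 4 / E1 * (\<Prod>i=1..4. y - e i / h2)) / (E2 * (\<Prod>i=5..8. y - 1 / e i))"
    by (rule divide_cancel_factor) (use nz in simp)
  finally have rhs: "(\<Prod>i=1..4. ?f - h2 / l\<^sup>2 / (e i / l)) / (\<Prod>i=5..8. ?f - e i / l)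
      = c * ((\<Prod>i=1..4. y - e i / h2) / (\<Prod>i=5..8. y - 1 / e i))"
    by (simp add: c_E)
  show ?thesis
    unfolding qE7_equation1_def xy_equation1_def k lhs rhs q_def[symmetric]
    by (simp only: mult_cancel_left c0 simp_thms)
qed

text \<open>Here \<open>l * (q * h1 / h2)\<close> stands for T(\<lambda>). No constant survives: on
  either side the numerator and the denominator carry equal monomial factors.\<close>

lemma qE7_equation2_iff:
  fixes l :: "'a::field"
  assumes nz: "l \<noteq> 0" "h1 \<noteq> 0" "h2 \<noteq> 0" "\<And>i. e i \<noteq> 0" "x \<noteq> 0" "y \<noteq> 0" "Y \<noteq> 0"
  defines "q \<equiv> q_of e h1 h2"
  shows "qE7_equation2 (\<lambda>i. e i / l) (h2 / l\<^sup>2) (h1 / l\<^sup>2) q (f_of l y) (g_of l x)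
           (f_of (l * (q * h1 / h2)) Y) \<longleftrightarrow> xy_equation2 e h1 h2 x y Y"
proof -
  have q0: "q \<noteq> 0"
    using nz by (simp add: q_def q_of_def)
  let ?f = "f_of l y" and ?g = "g_of l x" and ?F = "f_of (l * (q * h1 / h2)) Y"
  have k: "h2 / l\<^sup>2 / (h1 / l\<^sup>2) = h2 / h1" "h2 / l\<^sup>2 / (q * (h1 / l\<^sup>2)) = h2 / (q * h1)"
    using nz by simp_all
  have n1: "?f * ?g - h2 / h1 = - 1 / (x * y) * (h2 / h1 * x * y - 1)"
    and n2: "?F * ?g - h2 / (q * h1) = - (h2 / (q * h1)) / (x * Y) * (x * Y - 1)"
    and d1: "?f * ?g - 1 = - 1 / (x * y) * (x * y - 1)"
    and d2: "?F * ?g - 1 = - (h2 / (q * h1)) / (x * Y) * (q * h1 / h2 * x * Y - 1)"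
    using nz q0 by (simp_all add: f_of_def g_of_def field_simps)
  have "(?f * ?g - h2 / h1) * (?F * ?g - h2 / (q * h1)) / ((?f * ?g - 1) * (?F * ?g - 1))
      = (h2 / (q * h1) / (x * y * (x * Y))) * ((x * Y - 1) * (h2 / h1 * x * y - 1))
        / ((h2 / (q * h1) / (x * y * (x * Y))) * ((q * h1 / h2 * x * Y - 1) * (x * y - 1)))"
    unfolding n1 n2 d1 d2 by (simp add: mult_ac)
  also have "\<dots> = (x * Y - 1) * (h2 / h1 * x * y - 1) / ((q * h1 / h2 * x * Y - 1) * (x * y - 1))"
    by (rule divide_cancel_factor) (use nz q0 in simp)
  finally have lhs: "(?f * ?g - h2 / h1) * (?F * ?g - h2 / (q * h1)) / ((?f * ?g - 1) * (?F * ?g - 1))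
      = (x * Y - 1) / (q * h1 / h2 * x * Y - 1) * ((h2 / h1 * x * y - 1) / (x * y - 1))"
    by simp
  have p1: "?g - e i / l / (h1 / l\<^sup>2) = - (l / x) * (e i * x / h1 - 1)"
    and p2: "?g - 1 / (e i / l) = - (l / x) * (x / e i - 1)" for i
    using nz by (simp_all add: g_of_def field_simps power2_eq_square)
  have "(\<Prod>i=1..4. ?g - e i / l / (h1 / l\<^sup>2)) / (\<Prod>i=5..8. ?g - 1 / (e i / l))
      = ((l / x) ^ 4) * (\<Prod>i=1..4. e i * x / h1 - 1) / (((l / x) ^ 4) * (\<Prod>i=5..8. x / e i - 1))"
    unfolding p1 p2 prods by (simp add: eval_nat_numeral mult_ac)
  also have "\<dots> = (\<Prod>i=1..4. e i * x / h1 - 1) / (\<Prod>i=5..8. x / e i - 1)"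
    by (rule divide_cancel_factor) (use nz in simp)
  finally have rhs: "(\<Prod>i=1..4. ?g - e i / l / (h1 / l\<^sup>2)) / (\<Prod>i=5..8. ?g - 1 / (e i / l))
      = (\<Prod>i=1..4. e i * x / h1 - 1) / (\<Prod>i=5..8. x / e i - 1)" .
  show ?thesis
    unfolding qE7_equation2_def xy_equation2_def k lhs rhs q_def[symmetric] ..
qed

lemma L_q_eq: "L_q = q_of (\<lambda>i. L_of (K_e i)) (L_of K_h1) (L_of K_h2)"
  by (simp add: L_q_def q_of_def L_of.hom_divide L_of.hom_mult L_of.hom_power L_of.hom_prod)

lemma qE7_equation1_L_iff:
  assumes "x \<noteq> 0" "y \<noteq> 0" "X \<noteq> 0"
  shows "qE7_equation1 L_v L_k1 L_k2 L_q (f_of L_lambda y) (g_of L_lambda x) (g_of (inv T_L L_lambda) X)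
    \<longleftrightarrow> xy_equation1 (\<lambda>i. L_of (K_e i)) (L_of K_h1) (L_of K_h2) x y X"
proof -
  have "inv T_L L_lambda = L_lambda * (L_q * L_of K_h2 / L_of K_h1)"
    by (simp add: inv_T_L_lambda L_q_def L_of.hom_divide L_of.hom_mult)
  then show ?thesis
    using qE7_equation1_iff[of L_lambda "L_of K_h1" "L_of K_h2" "\<lambda>i. L_of (K_e i)" x y X] assms
    by (simp add: L_v_def[abs_def] L_k1_def L_k2_def L_of.hom_eq_0_iff flip: L_q_eq)
qed

lemma qE7_equation2_L_iff:
  assumes "x \<noteq> 0" "y \<noteq> 0" "Y \<noteq> 0"
  shows "qE7_equation2 L_v L_k1 L_k2 L_q (f_of L_lambda y) (g_of L_lambda x) (f_of (T_L L_lambda) Y)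
    \<longleftrightarrow> xy_equation2 (\<lambda>i. L_of (K_e i)) (L_of K_h1) (L_of K_h2) x y Y"
proof -
  have "T_L L_lambda = L_lambda * (L_q * L_of K_h1 / L_of K_h2)"
    by (simp add: T_L_lambda L_q_def L_of.hom_divide L_of.hom_mult)
  then show ?thesis
    using qE7_equation2_iff[of L_lambda "L_of K_h1" "L_of K_h2" "\<lambda>i. L_of (K_e i)" x y Y] assms
    by (simp add: L_v_def[abs_def] L_k1_def L_k2_def L_of.hom_eq_0_iff flip: L_q_eq)
qed

lemma qE7_equation1_T:
  "qE7_equation1 L_v L_k1 L_k2 L_q (f_of L_lambda (L_of K_y)) (g_of L_lambda (L_of K_x))
     (inv T_L (g_of L_lambda (L_of K_x)))"
proof -
  have "T_L (inv T_L L_lambda) = L_lambda"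
    using bij_T_L by (simp add: bij_is_surj surj_f_inv_f)
  then have "inv T_L (g_of L_lambda (L_of K_x)) = g_of (inv T_L L_lambda) (L_of (inv T K_x))"
    by (intro inv_T_L_eqI) (simp add: g_of_def T_L.hom_divide T_L_L_of inv_T T_T_inv)
  moreover
  have "xy_equation1 (\<lambda>i. L_of (K_e i)) (L_of K_h1) (L_of K_h2) (L_of K_x) (L_of K_y) (L_of (inv T K_x))"
    using equation1_T
    by (simp add: xy_equation1_def q_of_def L_of.hom_inject
        flip: L_of.hom_divide L_of.hom_mult L_of.hom_diff L_of.hom_one L_of.hom_prod L_of.hom_power)
  ultimately show ?thesis
    using qE7_equation1_L_iff[of "L_of K_x" "L_of K_y" "L_of (inv T K_x)"]
    by (simp add: inv_T L_of.hom_eq_0_iff T_inv.hom_eq_0_iff)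
qed

lemma qE7_equation2_T:
  "qE7_equation2 L_v L_k1 L_k2 L_q (f_of L_lambda (L_of K_y)) (g_of L_lambda (L_of K_x))
     (T_L (f_of L_lambda (L_of K_y)))"
proof -
  have "xy_equation2 (\<lambda>i. L_of (K_e i)) (L_of K_h1) (L_of K_h2) (L_of K_x) (L_of K_y) (L_of (T K_y))"
    using equation2_T
    by (simp add: xy_equation2_def q_of_def L_of.hom_inject
        flip: L_of.hom_divide L_of.hom_mult L_of.hom_diff L_of.hom_one L_of.hom_prod L_of.hom_power)
  then show ?thesis
    using qE7_equation2_L_iff[of "L_of K_x" "L_of K_y" "L_of (T K_y)"]
    by (simp add: f_of_def T_L.hom_divide T_L.hom_mult T_L.hom_one T_L_L_of L_of.hom_eq_0_iff T.hom_eq_0_iff)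
qed

section \<open>Indeterminacy points on $P^1 \times P^1$\<close>

definition xy_eval :: "complex \<Rightarrow> complex \<Rightarrow> xypoly \<Rightarrow> complex" where
  "xy_eval x y A = poly (poly A [:y:]) x"

lemma xy_eval_pCons: "xy_eval x y (pCons a A) = poly a x + y * xy_eval x y A"
  by (simp add: xy_eval_def)

interpretation xy_eval: comm_ring_hom "xy_eval x y"
  by unfold_locales (simp_all add: xy_eval_def)

lemma poly_eq_sum_atMost: "degree (p :: 'a::comm_ring_1 poly) \<le> n \<Longrightarrow> poly p x = (\<Sum>i\<le>n. coeff p i * x ^ i)"
  unfolding poly_altdef by (rule sum.mono_neutral_left) (auto simp: coeff_eq_0)

text \<open>The second homogeneous coordinates are 1, so the chosen bidegree does not influence the
  value at an affine point.\<close>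

lemma bihom_value_Affine:
  assumes "bidegree_le m n A"
  shows "bihom_value m n A (Affine x, Affine y) = xy_eval x y A"
proof -
  have deg: "degree A \<le> n" "\<And>j. degree (coeff A j) \<le> m"
    using assms by (auto simp: bidegree_le_def)
  have "poly A [:y:] = (\<Sum>j\<le>n. coeff A j * [:y:] ^ j)"
    using deg(1) by (rule poly_eq_sum_atMost)
  then have "xy_eval x y A = (\<Sum>j\<le>n. poly (coeff A j) x * y ^ j)"
    by (simp add: xy_eval_def poly_sum poly_power)
  also have "\<dots> = (\<Sum>j\<le>n. \<Sum>i\<le>m. coeff (coeff A j) i * x ^ i * y ^ j)"
    by (simp add: poly_eq_sum_atMost[OF deg(2)] sum_distrib_right)
  also have "\<dots> = (\<Sum>i\<le>m. \<Sum>j\<le>n. coeff (coeff A j) i * x ^ i * y ^ j)"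
    by (rule sum.swap)
  finally show ?thesis
    by (simp add: bihom_value_def)
qed

lemma tendsto_xy_eval:
  assumes "(u \<longlongrightarrow> x) F" "(w \<longlongrightarrow> y) F"
  shows "((\<lambda>t. xy_eval (u t) (w t) A) \<longlongrightarrow> xy_eval x y A) F"
proof (induction A)
  case 0
  then show ?case
    by (simp add: xy_eval_def)
next
  case (pCons a A)
  then show ?case
    unfolding xy_eval_pCons by (intro tendsto_intros assms)
qed

text \<open>
  If \<open>A\<close> vanishes along a curve through a point and \<open>B\<close> does not, then \<open>A / B\<close> tends to \<open>0\<close> there;
  along a curve on which the roles are exchanged it tends to \<open>\<infinity>\<close>.
\<close>

lemma indeterminate_at_AffineI:
  fixes t0 :: complex
  assumes F: "F = Fraction_Field.Fract A B" and "B \<noteq> 0"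
    and uw: "(u \<longlongrightarrow> x) (at t0)" "(w \<longlongrightarrow> y) (at t0)"
    and uw': "(u' \<longlongrightarrow> x) (at t0)" "(w' \<longlongrightarrow> y) (at t0)"
    and ev: "\<forall>\<^sub>F t in at t0. xy_eval (u t) (w t) A \<noteq> 0 \<and> xy_eval (u t) (w t) B = 0"
    and ev': "\<forall>\<^sub>F t in at t0. xy_eval (u' t) (w' t) A = 0 \<and> xy_eval (u' t) (w' t) B \<noteq> 0"
  shows "indeterminate_at F (Affine x, Affine y)"
  unfolding indeterminate_at_def
proof
  assume "\<exists>m n A' B'. bidegree_le m n A' \<and> bidegree_le m n B' \<and> B' \<noteq> 0 \<and> F = Fraction_Field.Fract A' B'
    \<and> (bihom_value m n A' (Affine x, Affine y) \<noteq> 0 \<or> bihom_value m n B' (Affine x, Affine y) \<noteq> 0)"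
  then obtain m n A' B' where A'B': "bidegree_le m n A'" "bidegree_le m n B'" "B' \<noteq> 0"
      "F = Fraction_Field.Fract A' B'"
    and nz: "bihom_value m n A' (Affine x, Affine y) \<noteq> 0 \<or> bihom_value m n B' (Affine x, Affine y) \<noteq> 0"
    by blast
  have "A * B' = A' * B"
    using F A'B' \<open>B \<noteq> 0\<close> by (simp add: eq_fract)
  then have cross: "xy_eval p q A * xy_eval p q B' = xy_eval p q A' * xy_eval p q B" for p q
    by (metis xy_eval.hom_mult)
  from nz have "xy_eval x y A' \<noteq> 0 \<or> xy_eval x y B' \<noteq> 0"
    by (simp add: bihom_value_Affine A'B')
  then show False
  proof
    \<comment> \<open>Along the first curve \<open>B\<close> vanishes, so by \<open>cross\<close>
      the product of \<open>A\<close> and \<open>B'\<close> vanishes, although near the point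
      neither factor does. The other case is symmetric, along the second curve.\<close>
    assume "xy_eval x y B' \<noteq> 0"
    then have "\<forall>\<^sub>F t in at t0. xy_eval (u t) (w t) B' \<noteq> 0"
      by (rule tendsto_imp_eventually_ne[OF tendsto_xy_eval[OF uw]])
    with ev have "\<forall>\<^sub>F t in at t0. False"
    proof eventually_elim
      case (elim t)
      then show ?case
        using cross[of "u t" "w t"] by simp
    qed
    then show False
      by simp
  next
    assume "xy_eval x y A' \<noteq> 0"
    then have "\<forall>\<^sub>F t in at t0. xy_eval (u' t) (w' t) A' \<noteq> 0"
      by (rule tendsto_imp_eventually_ne[OF tendsto_xy_eval[OF uw']])
    with ev' have "\<forall>\<^sub>F t in at t0. False"
    proof eventually_elim
      case (elim t)
      then show ?case
        using cross[of "u' t" "w' t"] by simp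
    qed
    then show False
      by simp
  qed
qed

lemma eventually_poly_nonzero:
  fixes p :: "complex poly"
  assumes "p \<noteq> 0"
  shows "\<forall>\<^sub>F t in at t0. poly p t \<noteq> 0"
proof -
  have "closed ({t. poly p t = 0} - {t0})"
    using poly_roots_finite[OF assms] by (intro finite_imp_closed) simp
  then have "open (- ({t. poly p t = 0} - {t0}))"
    by (rule open_Compl)
  then show ?thesis
    unfolding eventually_at_topological by blast
qed

section \<open>Polynomials of degree at most one in one of the variables\<close>

definition y_poly :: "complex poly \<Rightarrow> xypoly" where
  "y_poly p = map_poly (\<lambda>a. [:a:]) p"

definition x_poly :: "complex poly \<Rightarrow> xypoly" where
  "x_poly p = [:p:]"

lemma coeff_y_poly: "coeff (y_poly p) j = [:coeff p j:]"
  by (simp add: y_poly_def coeff_map_poly)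

interpretation y_poly: comm_ring_hom y_poly
proof
  show "y_poly (p + q) = y_poly p + y_poly q" for p q
    by (rule poly_eqI) (simp add: coeff_y_poly)
  have "(\<Sum>i\<in>S. [:f i:]) = [:sum f S:]" for f :: "nat \<Rightarrow> complex" and S
    by (induction S rule: infinite_finite_induct) simp_all
  then show "y_poly (p * q) = y_poly p * y_poly q" for p q
    by (intro poly_eqI) (simp add: coeff_y_poly coeff_mult mult_ac)
  show "y_poly 1 = 1"
    by (simp add: y_poly_def map_poly_1 pCons_one)
qed

interpretation x_poly: comm_ring_hom x_poly
  by unfold_locales (simp_all add: x_poly_def pCons_one)

definition linear_in_x :: "complex poly \<Rightarrow> complex poly \<Rightarrow> xypoly" where
  "linear_in_x a0 a1 = y_poly a0 + [:[:0, 1:]:] * y_poly a1"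

definition linear_in_y :: "complex poly \<Rightarrow> complex poly \<Rightarrow> xypoly" where
  "linear_in_y a0 a1 = x_poly a0 + [:0, 1:] * x_poly a1"

lemma coeff_linear_in_x: "coeff (linear_in_x a0 a1) j = [:coeff a0 j, coeff a1 j:]"
  by (simp add: linear_in_x_def coeff_y_poly)

lemma linear_in_y_eq: "linear_in_y a0 a1 = [:a0, a1:]"
  by (simp add: linear_in_y_def x_poly_def)

lemma xy_eval_y_poly: "xy_eval x y (y_poly p) = poly p y"
  by (induction p) (simp_all add: y_poly_def map_poly_pCons xy_eval_pCons xy_eval.hom_zero)

lemma xy_eval_smult: "xy_eval x y (smult a A) = poly a x * xy_eval x y A"
  by (simp add: xy_eval_def)

lemma xy_eval_linear_in_x: "xy_eval x y (linear_in_x a0 a1) = poly a0 y + x * poly a1 y"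
  by (simp add: linear_in_x_def xy_eval.hom_add xy_eval_y_poly xy_eval_smult)

lemma xy_eval_linear_in_y: "xy_eval x y (linear_in_y a0 a1) = poly a0 x + y * poly a1 x"
  by (simp add: linear_in_y_eq xy_eval_pCons xy_eval.hom_zero)

text \<open>The form of degree 4 is used even when the degree of \<open>p\<close> is smaller, so
  that the value at infinity is the coefficient of t^4 and may vanish.\<close>

definition quartic_value :: "complex poly \<Rightarrow> P1 \<Rightarrow> complex" where
  "quartic_value p t = (case homogeneous_coords t of (t0, t1) \<Rightarrow> \<Sum>i\<le>4. coeff p i * t0 ^ i * t1 ^ (4 - i))"

lemma quartic_value_Affine: "degree p \<le> 4 \<Longrightarrow> quartic_value p (Affine t) = poly p t"
  by (simp add: quartic_value_def poly_eq_sum_atMost)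

lemma quartic_value_Infinity: "quartic_value p Infinity = coeff p 4"
proof -
  have "coeff p i * 1 ^ i * 0 ^ (4 - i) = (if i = 4 then coeff p 4 else 0)" if "i \<le> 4" for i :: nat
    using that by (cases "i = 4") auto
  then have "(\<Sum>i\<le>4. coeff p i * 1 ^ i * 0 ^ (4 - i)) = (\<Sum>i\<le>4::nat. if i = 4 then coeff p 4 else 0)"
    by (intro sum.cong) auto
  then show ?thesis
    by (simp add: quartic_value_def)
qed

text \<open>The form a0 + u a1, of degree 4 in \<open>t\<close> and 1 in \<open>u\<close>. Leaving
  open which of x and y is \<open>t\<close> lets one analysis serve both equations.\<close>

definition pencil_value :: "complex poly \<Rightarrow> complex poly \<Rightarrow> P1 \<Rightarrow> P1 \<Rightarrow> complex" where
  "pencil_value a0 a1 t u = (case homogeneous_coords u of (u0, u1) \<Rightarrow>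
     u1 * quartic_value a0 t + u0 * quartic_value a1 t)"

lemma bihom_value_linear_in_x:
  "bihom_value 1 4 (linear_in_x a0 a1) (x, y) = pencil_value a0 a1 y x"
  by (cases "homogeneous_coords x"; cases "homogeneous_coords y")
    (simp add: bihom_value_def pencil_value_def quartic_value_def coeff_linear_in_x
      sum_distrib_left mult_ac)

lemma bihom_value_linear_in_y:
  "bihom_value 4 1 (linear_in_y a0 a1) (x, y) = pencil_value a0 a1 x y"
  by (cases "homogeneous_coords x"; cases "homogeneous_coords y")
    (simp add: bihom_value_def pencil_value_def quartic_value_def linear_in_y_eq
      sum_distrib_left sum.distrib mult_ac)

lemma bidegree_le_linear_in_x:
  assumes "degree a0 \<le> 4" "degree a1 \<le> 4"
  shows "bidegree_le 1 4 (linear_in_x a0 a1)"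
proof -
  have "degree (linear_in_x a0 a1) \<le> 4"
    using assms by (intro degree_le) (auto simp: coeff_linear_in_x coeff_eq_0)
  then show ?thesis
    by (auto simp: bidegree_le_def coeff_linear_in_x)
qed

lemma bidegree_le_linear_in_y:
  assumes "degree a0 \<le> 4" "degree a1 \<le> 4"
  shows "bidegree_le 4 1 (linear_in_y a0 a1)"
  using assms by (auto simp: bidegree_le_def linear_in_y_eq coeff_pCons split: nat.split)

text \<open>
  With \<open>w = t u\<close>, the pencil below is the solution
  \<open>((w - k) d - r n (w - 1)) / ((w - k) d - n (w - 1))\<close> of either equation, divided by \<open>t\<close>:
  for the first equation \<open>t = y\<close>, \<open>u = x\<close>, for the second one \<open>t = x\<close>, \<open>u = y\<close>.
\<close>

locale pencil =
  fixes n d a0 :: "complex poly" and k r :: complex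
  assumes degree_n: "degree n \<le> 4" and degree_d: "degree d \<le> 4"
    and lead: "coeff n 4 = coeff d 4" "coeff d 4 \<noteq> 0"
    and a0: "pCons 0 a0 = smult r n - smult k d"
    and at_0: "poly n 0 \<noteq> 0" "poly d 0 \<noteq> 0"
    and k: "k \<noteq> 0" "k \<noteq> 1" and r: "r \<noteq> 1"
    and no_common_root: "poly n t = 0 \<Longrightarrow> poly d t \<noteq> 0"
begin

text \<open>In powers of \<open>u\<close>, numerator and denominator of the solution are (r n - k d)
  + u t (d - r n) and (n - k d) + u t (d - n). As \<open>t\<close> divides r n - k d, the division
  by \<open>t\<close> is carried out in the numerator, and both degrees in \<open>t\<close> stay at
  most 4.\<close>

definition "a1 = d - smult r n"
definition "b0 = n - smult k d"
definition "b1 = pCons 0 (d - n)"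

lemma poly_a0: "t * poly a0 t = r * poly n t - k * poly d t"
  using arg_cong[OF a0, of "\<lambda>p. poly p t"] by simp

text \<open>The product t a0 has degree at most 4. The vanishing of the coefficient of t^4 in
  \<open>a0\<close> decides the case t = \<infinity>.\<close>

lemma degree_a0: "degree a0 \<le> 4" and coeff_a0: "coeff a0 4 = 0"
proof -
  have coeff: "coeff a0 i = 0" if "i \<ge> 4" for i
  proof -
    have "coeff a0 i = coeff (smult r n - smult k d) (Suc i)"
      by (simp flip: a0)
    then show ?thesis
      using that degree_n degree_d by (simp add: coeff_eq_0)
  qed
  then show "coeff a0 4 = 0"
    by simp
  show "degree a0 \<le> 4"
    using coeff by (intro degree_le) auto
qed

lemma degree_a1: "degree a1 \<le> 4" and degree_b0: "degree b0 \<le> 4"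
  using degree_n degree_d by (auto simp: a1_def b0_def intro!: degree_diff_le order_trans[OF degree_smult_le])

text \<open>The equal coefficients of t^4 in \<open>n\<close> and \<open>d\<close> cancel before the
  multiplication by \<open>t\<close>.\<close>

lemma degree_b1: "degree b1 \<le> 4"
proof (rule degree_le, intro allI impI)
  fix i :: nat assume "4 < i"
  then obtain j where "i = Suc j" "4 \<le> j"
    by (cases i) auto
  then have "coeff b1 i = coeff d j - coeff n j"
    by (simp add: b1_def)
  then show "coeff b1 i = 0"
    using lead degree_n degree_d \<open>4 \<le> j\<close> by (cases "j = 4") (auto simp: coeff_eq_0)
qed

lemmas degrees = degree_a0 degree_a1 degree_b0 degree_b1

lemma coeff_4: "coeff a1 4 = (1 - r) * coeff d 4" "coeff b0 4 = (1 - k) * coeff d 4"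
  by (simp_all add: a1_def b0_def lead algebra_simps)

text \<open>This is the determinant that eliminates \<open>u\<close> from the two forms. The
  constant is nonzero, so the zero curves can meet only over the roots of \<open>n\<close> and
  \<open>d\<close>.\<close>

lemma resultant:
  "poly a0 t * poly b1 t - poly a1 t * poly b0 t = (r - 1) * (1 - k) * (poly n t * poly d t)"
proof -
  have "poly a0 t * poly b1 t = (t * poly a0 t) * (poly d t - poly n t)"
    by (simp add: b1_def)
  also have "\<dots> = (r * poly n t - k * poly d t) * (poly d t - poly n t)"
    by (simp only: poly_a0)
  finally show ?thesis
    by (simp add: a1_def b0_def algebra_simps)
qed

lemma root_nonzero: "poly n t = 0 \<or> poly d t = 0 \<Longrightarrow> t \<noteq> 0"
  using at_0 by auto

lemma common_zero_iff_Affine: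
  "poly a0 t + u * poly a1 t = 0 \<and> poly b0 t + u * poly b1 t = 0 \<longleftrightarrow>
   poly n t = 0 \<and> u = k / t \<or> poly d t = 0 \<and> u = 1 / t"
proof -
  define N D w where "N = poly n t" and "D = poly d t" and "w = u * t"
  have A: "t * (poly a0 t + u * poly a1 t) = (w - k) * D - r * N * (w - 1)"
    using poly_a0[of t] by (simp add: a1_def N_def D_def w_def algebra_simps)
  have B: "poly b0 t + u * poly b1 t = (w - k) * D - N * (w - 1)"
    by (simp add: b0_def b1_def N_def D_def w_def algebra_simps)
  have ND: "\<not> (N = 0 \<and> D = 0)"
    using no_common_root by (auto simp: N_def D_def)
  show ?thesis
  proof
    assume *: "poly a0 t + u * poly a1 t = 0 \<and> poly b0 t + u * poly b1 t = 0"
    then have 1: "(w - k) * D = r * N * (w - 1)" "(w - k) * D = N * (w - 1)"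
      using A B by auto
    \<comment> \<open>Since r is not 1, comparison leaves N = 0 or w = 1. The first yields w = k as
      D is then nonzero, the second D = 0 as k is not 1.\<close>
    then have "r * N * (w - 1) = N * (w - 1)"
      by simp
    then have "(1 - r) * (N * (w - 1)) = 0"
      by (simp add: algebra_simps)
    then have "N = 0 \<or> w = 1"
      using r by simp
    then have "N = 0 \<and> w = k \<or> D = 0 \<and> w = 1"
      using 1 ND k by auto
    moreover have "t \<noteq> 0"
      using calculation k by (auto simp: w_def)
    ultimately show "poly n t = 0 \<and> u = k / t \<or> poly d t = 0 \<and> u = 1 / t"
      by (auto simp: N_def D_def w_def field_simps)
  next
    assume *: "poly n t = 0 \<and> u = k / t \<or> poly d t = 0 \<and> u = 1 / t"
    then have t: "t \<noteq> 0"
      using root_nonzero by blast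
    then have "N = 0 \<and> w = k \<or> D = 0 \<and> w = 1"
      using * by (auto simp: N_def D_def w_def)
    then have "t * (poly a0 t + u * poly a1 t) = 0" "poly b0 t + u * poly b1 t = 0"
      unfolding A B by auto
    then show "poly a0 t + u * poly a1 t = 0 \<and> poly b0 t + u * poly b1 t = 0"
      using t by simp
  qed
qed

lemma common_zero_iff:
  "pencil_value a0 a1 t u = 0 \<and> pencil_value b0 b1 t u = 0 \<longleftrightarrow>
   (\<exists>t'. t = Affine t' \<and> (poly n t' = 0 \<and> u = Affine (k / t') \<or> poly d t' = 0 \<and> u = Affine (1 / t')))"
proof (cases t; cases u)
  fix t' u' assume "t = Affine t'" "u = Affine u'"
  then show ?thesis
    using common_zero_iff_Affine[of t' u']
    by (simp add: pencil_value_def quartic_value_Affine degrees)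
next
  fix t' assume tu: "t = Affine t'" "u = Infinity"
  \<comment> \<open>At u = \<infinity> only \<open>a1\<close> and \<open>b1\<close> count. The value
    t' = 0 is special because \<open>b1\<close> always vanishes there; then d(0) = r n(0) = k d(0),
    against k \<noteq> 1 and d(0) \<noteq> 0.\<close>
  have "\<not> (poly a1 t' = 0 \<and> poly b1 t' = 0)"
  proof
    assume "poly a1 t' = 0 \<and> poly b1 t' = 0"
    then have *: "poly d t' = r * poly n t'" "t' = 0 \<or> poly d t' = poly n t'"
      by (auto simp: a1_def b1_def)
    show False
    proof (cases "t' = 0")
      case True
      then have "(1 - k) * poly d 0 = 0"
        using *(1) poly_a0[of 0] by (simp add: algebra_simps)
      then show False
        using at_0 k by simp
    next
      case False
      then have eq: "poly d t' = poly n t'"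
        using *(2) by simp
      with *(1) have "(1 - r) * poly n t' = 0"
        by (simp add: algebra_simps)
      then show False
        using eq r no_common_root[of t'] by simp
    qed
  qed
  with tu show ?thesis
    by (simp add: pencil_value_def quartic_value_Affine degrees)
next
  fix u' assume tu: "t = Infinity" "u = Affine u'"
  \<comment> \<open>At t = \<infinity> the first form forces u' = 0, and the second is then (1 - k)
    times the nonzero coefficient of t^4 in \<open>d\<close>.\<close>
  have "pencil_value a0 a1 t u = u' * ((1 - r) * coeff d 4)"
    "pencil_value b0 b1 t u = (1 - k) * coeff d 4 + u' * coeff b1 4"
    by (simp_all add: tu pencil_value_def quartic_value_Infinity coeff_a0 coeff_4)
  then show ?thesis
    using tu lead r k by auto
next
  assume "t = Infinity" "u = Infinity"
  then show ?thesis
    using lead r by (simp add: pencil_value_def quartic_value_Infinity coeff_4)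
qed

lemma eventually_nonzero: "\<forall>\<^sub>F t in at t0. poly n t * poly d t \<noteq> 0"
proof -
  have "n * d \<noteq> 0"
    using at_0 by auto
  from eventually_poly_nonzero[OF this] show ?thesis
    by simp
qed

text \<open>The curves are the graphs of -b0/b1 and -a0/a1, on which the denominator and the
  numerator vanish, respectively. On each of them the other form is, up to sign, the resultant
  divided by b1 or a1.\<close>

lemma curves:
  assumes "poly n t0 = 0 \<and> u0 = k / t0 \<or> poly d t0 = 0 \<and> u0 = 1 / t0"
  obtains u u' where "(u \<longlongrightarrow> u0) (at t0)" "(u' \<longlongrightarrow> u0) (at t0)"
    "\<forall>\<^sub>F t in at t0. poly a0 t + u t * poly a1 t \<noteq> 0 \<and> poly b0 t + u t * poly b1 t = 0"
    "\<forall>\<^sub>F t in at t0. poly a0 t + u' t * poly a1 t = 0 \<and> poly b0 t + u' t * poly b1 t \<noteq> 0"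
proof -
  have zero: "poly a0 t0 + u0 * poly a1 t0 = 0" "poly b0 t0 + u0 * poly b1 t0 = 0"
    using common_zero_iff_Affine assms by blast+
  have t0: "t0 \<noteq> 0"
    using assms root_nonzero by blast
  \<comment> \<open>At t = 0 the relation for \<open>a0\<close> reads r n(0) = k d(0), and the
    right-hand side is nonzero.\<close>
  have r0: "r \<noteq> 0"
    using poly_a0[of 0] at_0 k by auto
  \<comment> \<open>At a root of \<open>n\<close> one has a1 = d and b1 = t d; at a root of
    \<open>d\<close> one has a1 = - r n and b1 = - t n.\<close>
  have nz: "poly a1 t0 \<noteq> 0" "poly b1 t0 \<noteq> 0"
    using assms no_common_root[of t0] t0 r0 by (auto simp: a1_def b1_def)
  have u0: "u0 = - poly b0 t0 / poly b1 t0" "u0 = - poly a0 t0 / poly a1 t0"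
    using zero nz by (simp_all add: field_simps add_eq_0_iff)
  have ev: "\<forall>\<^sub>F t in at t0. poly a1 t \<noteq> 0" "\<forall>\<^sub>F t in at t0. poly b1 t \<noteq> 0"
    using nz by (intro eventually_poly_nonzero; auto)+
  have res: "(r - 1) * (1 - k) \<noteq> 0"
    using r k by simp
  show thesis
  proof (rule that)
    show "((\<lambda>t. - poly b0 t / poly b1 t) \<longlongrightarrow> u0) (at t0)"
      unfolding u0(1) using nz by (intro tendsto_intros)
    show "((\<lambda>t. - poly a0 t / poly a1 t) \<longlongrightarrow> u0) (at t0)"
      unfolding u0(2) using nz by (intro tendsto_intros)
    show "\<forall>\<^sub>F t in at t0. poly a0 t + - poly b0 t / poly b1 t * poly a1 t \<noteq> 0
        \<and> poly b0 t + - poly b0 t / poly b1 t * poly b1 t = 0"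
      using ev(2) eventually_nonzero
    proof eventually_elim
      case (elim t)
      then have "poly a0 t * poly b1 t - poly a1 t * poly b0 t \<noteq> 0"
        using res by (simp add: resultant)
      then show ?case
        using elim by (simp add: field_simps)
    qed
    show "\<forall>\<^sub>F t in at t0. poly a0 t + - poly a0 t / poly a1 t * poly a1 t = 0
        \<and> poly b0 t + - poly a0 t / poly a1 t * poly b1 t \<noteq> 0"
      using ev(1) eventually_nonzero
    proof eventually_elim
      case (elim t)
      then have "poly a0 t * poly b1 t - poly a1 t * poly b0 t \<noteq> 0"
        using res by (simp add: resultant)
      then show ?case
        using elim by (simp add: field_simps)
    qed
  qed
qed

lemma den_at_0: "poly b0 0 \<noteq> 0"
proof -
  have "poly b0 0 = (1 - r) * poly n 0"
    using poly_a0[of 0] by (simp add: b0_def algebra_simps)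
  then show ?thesis
    using r at_0 by simp
qed

lemma den_nonzero: "linear_in_x b0 b1 \<noteq> 0" "linear_in_y b0 b1 \<noteq> 0"
  using den_at_0 xy_eval_linear_in_x[of 0 0 b0 b1] xy_eval_linear_in_y[of 0 0 b0 b1]
  by (auto simp: xy_eval.hom_zero)

lemma indeterminate_linear_in_x:
  "indeterminate_at (Fraction_Field.Fract (linear_in_x a0 a1) (linear_in_x b0 b1)) (x, y) \<longleftrightarrow>
   (\<exists>t. y = Affine t \<and> (poly n t = 0 \<and> x = Affine (k / t) \<or> poly d t = 0 \<and> x = Affine (1 / t)))"
  (is "?I \<longleftrightarrow> ?Z")
proof
  assume I: ?I
  have bi: "bidegree_le 1 4 (linear_in_x a0 a1)" "bidegree_le 1 4 (linear_in_x b0 b1)"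
    by (rule bidegree_le_linear_in_x degrees)+
  have "bihom_value 1 4 (linear_in_x a0 a1) (x, y) = 0 \<and> bihom_value 1 4 (linear_in_x b0 b1) (x, y) = 0"
    using I bi den_nonzero(1) unfolding indeterminate_at_def by blast
  then show ?Z
    by (simp only: bihom_value_linear_in_x common_zero_iff)
next
  assume ?Z
  then obtain t u where xy: "x = Affine u" "y = Affine t"
    and tu: "poly n t = 0 \<and> u = k / t \<or> poly d t = 0 \<and> u = 1 / t"
    by blast
  from tu obtain v v' where v: "(v \<longlongrightarrow> u) (at t)" "(v' \<longlongrightarrow> u) (at t)"
    "\<forall>\<^sub>F t in at t. poly a0 t + v t * poly a1 t \<noteq> 0 \<and> poly b0 t + v t * poly b1 t = 0"
    "\<forall>\<^sub>F t in at t. poly a0 t + v' t * poly a1 t = 0 \<and> poly b0 t + v' t * poly b1 t \<noteq> 0"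
    by (rule curves)
  then show ?I
    unfolding xy
    by (intro indeterminate_at_AffineI[OF refl den_nonzero(1) v(1) tendsto_ident_at v(2) tendsto_ident_at])
      (use v(3,4) in \<open>simp_all only: xy_eval_linear_in_x\<close>)
qed

lemma indeterminate_linear_in_y:
  "indeterminate_at (Fraction_Field.Fract (linear_in_y a0 a1) (linear_in_y b0 b1)) (x, y) \<longleftrightarrow>
   (\<exists>t. x = Affine t \<and> (poly n t = 0 \<and> y = Affine (k / t) \<or> poly d t = 0 \<and> y = Affine (1 / t)))"
  (is "?I \<longleftrightarrow> ?Z")
proof
  assume I: ?I
  have bi: "bidegree_le 4 1 (linear_in_y a0 a1)" "bidegree_le 4 1 (linear_in_y b0 b1)"
    by (rule bidegree_le_linear_in_y degrees)+
  have "bihom_value 4 1 (linear_in_y a0 a1) (x, y) = 0 \<and> bihom_value 4 1 (linear_in_y b0 b1) (x, y) = 0"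
    using I bi den_nonzero(2) unfolding indeterminate_at_def by blast
  then show ?Z
    by (simp only: bihom_value_linear_in_y common_zero_iff)
next
  assume ?Z
  then obtain t u where xy: "x = Affine t" "y = Affine u"
    and tu: "poly n t = 0 \<and> u = k / t \<or> poly d t = 0 \<and> u = 1 / t"
    by blast
  from tu obtain v v' where v: "(v \<longlongrightarrow> u) (at t)" "(v' \<longlongrightarrow> u) (at t)"
    "\<forall>\<^sub>F t in at t. poly a0 t + v t * poly a1 t \<noteq> 0 \<and> poly b0 t + v t * poly b1 t = 0"
    "\<forall>\<^sub>F t in at t. poly a0 t + v' t * poly a1 t = 0 \<and> poly b0 t + v' t * poly b1 t \<noteq> 0"
    by (rule curves)
  then show ?I
    unfolding xy
    by (intro indeterminate_at_AffineI[OF refl den_nonzero(2) tendsto_ident_at v(1) tendsto_ident_at v(2)])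
      (use v(3,4) in \<open>simp_all only: xy_eval_linear_in_y\<close>)
qed

end

section \<open>Solving the equations\<close>

text \<open>Common shape of the two equations: (U - 1) / (U - r) * (w - k) / (w - 1) = n / d with w
  = x y, where U is X y for the first and Y x for the second one.\<close>

definition core_den :: "'a::field \<Rightarrow> 'a \<Rightarrow> 'a \<Rightarrow> 'a \<Rightarrow> 'a" where
  "core_den k n d w = (w - k) * d - n * (w - 1)"

definition core_solution :: "'a::field \<Rightarrow> 'a \<Rightarrow> 'a \<Rightarrow> 'a \<Rightarrow> 'a \<Rightarrow> 'a" where
  "core_solution r k n d w = ((w - k) * d - r * n * (w - 1)) / core_den k n d w"

text \<open>These conditions turn the equation into a linear one for U. They are nonvanishing
  statements about ring expressions, so that values under a homomorphism can verify them.\<close>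

definition core_nondeg :: "'a::field \<Rightarrow> 'a \<Rightarrow> 'a \<Rightarrow> 'a \<Rightarrow> 'a \<Rightarrow> bool" where
  "core_nondeg r k n d w \<longleftrightarrow> r - 1 \<noteq> 0 \<and> w - 1 \<noteq> 0 \<and> w - k \<noteq> 0 \<and> n \<noteq> 0 \<and> d \<noteq> 0 \<and> core_den k n d w \<noteq> 0"

lemma core_equation_iff:
  fixes U :: "'a::field"
  assumes "core_nondeg r k n d w"
  shows "(U - 1) / (U - r) * ((w - k) / (w - 1)) = n / d \<longleftrightarrow> U = core_solution r k n d w"
proof -
  have nz: "r - 1 \<noteq> 0" "w - 1 \<noteq> 0" "w - k \<noteq> 0" "n \<noteq> 0" "d \<noteq> 0" and den: "core_den k n d w \<noteq> 0"
    using assms by (auto simp: core_nondeg_def)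
  have sol: "U = core_solution r k n d w \<longleftrightarrow> U * core_den k n d w = (w - k) * d - r * n * (w - 1)"
    using den by (simp add: core_solution_def field_simps)
  have "U * core_den k n d w - ((w - k) * d - r * n * (w - 1))
      = (U - 1) * (w - k) * d - n * ((U - r) * (w - 1))"
    by (simp add: core_den_def algebra_simps)
  then have sol': "U = core_solution r k n d w \<longleftrightarrow> (U - 1) * (w - k) * d = n * ((U - r) * (w - 1))"
    using sol by (metis eq_iff_diff_eq_0)
  show ?thesis
  proof (cases "U - r = 0")
    \<comment> \<open>At U = r the quotient is 0 by convention, while n / d is not; the linear
      equation fails as well, its left side being (r - 1) (w - k) d and its right side 0.\<close>
    case True
    then have "(U - 1) * (w - k) * d \<noteq> 0"
      using nz by auto
    then show ?thesis
      using True nz sol' by simp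
  next
    case False
    then show ?thesis
      unfolding sol' using nz by (simp only: times_divide_times_eq frac_eq_eq mult_eq_0_iff simp_thms)
  qed
qed

lemma (in frac_hom) core_transfer:
  assumes vals: "frac_val h R r" "frac_val h K k" "frac_val h N n" "frac_val h D d" "frac_val h W w"
    and nd: "core_nondeg r k n d w"
  shows "core_nondeg R K N D W" "frac_val h (core_solution R K N D W) (core_solution r k n d w)"
proof -
  have den: "frac_val h (core_den K N D W) (core_den k n d w)"
    unfolding core_den_def by (intro frac_val_intros vals)
  have diffs: "frac_val h (R - 1) (r - 1)" "frac_val h (W - 1) (w - 1)" "frac_val h (W - K) (w - k)"
    by (intro frac_val_intros vals)+
  from nd show "core_nondeg R K N D W"
    unfolding core_nondeg_def
    using frac_val_nonzero[OF diffs(1)] frac_val_nonzero[OF diffs(2)] frac_val_nonzero[OF diffs(3)]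
      frac_val_nonzero[OF vals(3)] frac_val_nonzero[OF vals(4)] frac_val_nonzero[OF den] by blast
  show "frac_val h (core_solution R K N D W) (core_solution r k n d w)"
    unfolding core_solution_def using nd
    by (intro frac_val_divide den frac_val_intros vals) (auto simp: core_nondeg_def)
qed

definition eq1_r :: "(nat \<Rightarrow> 'a::field) \<Rightarrow> 'a \<Rightarrow> 'a \<Rightarrow> 'a" where
  "eq1_r e h1 h2 = q_of e h1 h2 * h2 / h1"

definition eq1_n :: "(nat \<Rightarrow> 'a::field) \<Rightarrow> 'a \<Rightarrow> 'a \<Rightarrow> 'a" where
  "eq1_n e h2 y = (\<Prod>i=1..4. y - e i / h2)"

definition eq1_d :: "(nat \<Rightarrow> 'a::field) \<Rightarrow> 'a \<Rightarrow> 'a" where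
  "eq1_d e y = (\<Prod>i=5..8. y - 1 / e i)"

text \<open>With s = q h1 / h2 and k = h1 / h2, the factors of the second equation are s (Y x - 1/s)
  and (x y - k) / k. Hence \<open>r\<close> is 1/s, and the constants s and 1/k are absorbed into
  the two products.\<close>

definition eq2_r :: "(nat \<Rightarrow> 'a::field) \<Rightarrow> 'a \<Rightarrow> 'a \<Rightarrow> 'a" where
  "eq2_r e h1 h2 = 1 / (q_of e h1 h2 * h1 / h2)"

definition eq2_n :: "(nat \<Rightarrow> 'a::field) \<Rightarrow> 'a \<Rightarrow> 'a \<Rightarrow> 'a \<Rightarrow> 'a" where
  "eq2_n e h1 h2 x = q_of e h1 h2 * h1 / h2 * (\<Prod>i=1..4. e i * x / h1 - 1)"

definition eq2_d :: "(nat \<Rightarrow> 'a::field) \<Rightarrow> 'a \<Rightarrow> 'a \<Rightarrow> 'a \<Rightarrow> 'a" where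
  "eq2_d e h1 h2 x = h2 / h1 * (\<Prod>i=5..8. x / e i - 1)"

definition solution1 :: "(nat \<Rightarrow> 'a::field) \<Rightarrow> 'a \<Rightarrow> 'a \<Rightarrow> 'a \<Rightarrow> 'a \<Rightarrow> 'a" where
  "solution1 e h1 h2 x y =
     core_solution (eq1_r e h1 h2) (h1 / h2) (eq1_n e h2 y) (eq1_d e y) (x * y) / y"

definition solution2 :: "(nat \<Rightarrow> 'a::field) \<Rightarrow> 'a \<Rightarrow> 'a \<Rightarrow> 'a \<Rightarrow> 'a \<Rightarrow> 'a" where
  "solution2 e h1 h2 x y =
     core_solution (eq2_r e h1 h2) (h1 / h2) (eq2_n e h1 h2 x) (eq2_d e h1 h2 x) (x * y) / x"

lemma xy_equation1_iff:
  fixes X :: "'a::field"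
  assumes "core_nondeg (eq1_r e h1 h2) (h1 / h2) (eq1_n e h2 y) (eq1_d e y) (x * y)" "y \<noteq> 0"
  shows "xy_equation1 e h1 h2 x y X \<longleftrightarrow> X = solution1 e h1 h2 x y"
  using core_equation_iff[OF assms(1), of "X * y"] assms(2)
  by (simp add: xy_equation1_def solution1_def eq1_r_def eq1_n_def eq1_d_def eq_divide_eq)

lemma xy_equation2_iff:
  fixes Y :: "'a::field"
  assumes nd: "core_nondeg (eq2_r e h1 h2) (h1 / h2) (eq2_n e h1 h2 x) (eq2_d e h1 h2 x) (x * y)"
    and "x \<noteq> 0" "h1 \<noteq> 0" "h2 \<noteq> 0"
  shows "xy_equation2 e h1 h2 x y Y \<longleftrightarrow> Y = solution2 e h1 h2 x y"
proof -
  define s where "s = q_of e h1 h2 * h1 / h2"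
  define k where "k = h1 / h2"
  have "s \<noteq> 0"
    using nd by (auto simp: core_nondeg_def eq2_n_def s_def)
  have "k \<noteq> 0"
    using assms by (simp add: k_def)
  define N where "N = (\<Prod>i=1..4. e i * x / h1 - 1)"
  define D where "D = (\<Prod>i=5..8. x / e i - 1)"
  have "s * x * Y - 1 = s * (Y * x - 1 / s)" "h2 / h1 * x * y - 1 = (x * y - k) / k"
    using \<open>s \<noteq> 0\<close> \<open>k \<noteq> 0\<close> assms by (simp_all add: k_def field_simps)
  then have "(x * Y - 1) / (s * x * Y - 1) * ((h2 / h1 * x * y - 1) / (x * y - 1))
      = 1 / (s * k) * ((Y * x - 1) / (Y * x - 1 / s) * ((x * y - k) / (x * y - 1)))"
    by (simp add: mult_ac)
  moreover have "N / D = 1 / (s * k) * (s * N / (h2 / h1 * D))"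
    using \<open>s \<noteq> 0\<close> assms by (simp add: k_def)
  ultimately have "xy_equation2 e h1 h2 x y Y \<longleftrightarrow>
      (Y * x - 1) / (Y * x - 1 / s) * ((x * y - k) / (x * y - 1)) = s * N / (h2 / h1 * D)"
    unfolding xy_equation2_def s_def[symmetric] N_def[symmetric] D_def[symmetric]
    using \<open>s \<noteq> 0\<close> \<open>k \<noteq> 0\<close> by (simp only: mult_cancel_left) simp
  also have "\<dots> \<longleftrightarrow> Y * x = core_solution (eq2_r e h1 h2) (h1 / h2) (eq2_n e h1 h2 x) (eq2_d e h1 h2 x) (x * y)"
    using core_equation_iff[OF nd, of "Y * x"]
    by (simp only: eq2_r_def eq2_n_def eq2_d_def s_def k_def N_def D_def)
  finally show ?thesis
    using assms by (simp add: solution2_def eq_divide_eq)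
qed

section \<open>Values of the solutions under a homomorphism\<close>

context frac_hom
begin

context
  fixes E :: "nat \<Rightarrow> 'r fract" and e :: "nat \<Rightarrow> 'e" and H1 h1 H2 h2 X x Y y
  assumes vals: "\<And>i. i \<in> {1..8} \<Longrightarrow> frac_val h (E i) (e i)" "frac_val h H1 h1" "frac_val h H2 h2"
      "frac_val h X x" "frac_val h Y y"
    and nz: "\<And>i. i \<in> {1..8} \<Longrightarrow> e i \<noteq> 0" "h1 \<noteq> 0" "h2 \<noteq> 0"
begin

lemma q_val: "frac_val h (q_of E H1 H2) (q_of e h1 h2)" "q_of e h1 h2 \<noteq> 0"
proof -
  have prod_nz: "(\<Prod>i=1..8. e i) \<noteq> 0"
    using nz(1) by (auto simp: prod_zero_iff)
  then show "frac_val h (q_of E H1 H2) (q_of e h1 h2)"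
    unfolding q_of_def by (intro frac_val_intros vals)
  show "q_of e h1 h2 \<noteq> 0"
    unfolding q_of_def using prod_nz nz(2,3) by simp
qed

lemma eq1_vals:
  "frac_val h (eq1_r E H1 H2) (eq1_r e h1 h2)" "frac_val h (H1 / H2) (h1 / h2)"
  "frac_val h (eq1_n E H2 Y) (eq1_n e h2 y)" "frac_val h (eq1_d E Y) (eq1_d e y)"
  "frac_val h (X * Y) (x * y)"
  unfolding eq1_r_def eq1_n_def eq1_d_def using nz q_val
  by (intro frac_val_intros vals; force)+

lemma eq2_vals:
  "frac_val h (eq2_r E H1 H2) (eq2_r e h1 h2)"
  "frac_val h (eq2_n E H1 H2 X) (eq2_n e h1 h2 x)" "frac_val h (eq2_d E H1 H2 X) (eq2_d e h1 h2 x)"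
  unfolding eq2_r_def eq2_n_def eq2_d_def using nz q_val
  by (intro frac_val_intros vals; force)+

lemmas eq1_transfer = core_transfer[OF eq1_vals]
lemmas eq2_transfer = core_transfer[OF eq2_vals(1) eq1_vals(2) eq2_vals(2,3) eq1_vals(5)]

end

end

section \<open>Specialization of the parameters\<close>

interpretation xy_const: field_hom xy_const
  by unfold_locales
    (simp_all add: xy_const_def One_fract_def pCons_one)

lemma xy_gens_to_fract:
  "xy_const a = to_fract [:[:a:]:]" "xy_x = to_fract [:[:0, 1:]:]" "xy_y = to_fract [:0, 1:]"
  by (simp_all add: xy_const_def xy_x_def xy_y_def to_fract_def)

lemma xy_nonzero: "xy_x \<noteq> 0" "xy_y \<noteq> 0"
  by (simp_all add: xy_gens_to_fract)

text \<open>The test point x = y = 0: an expression with a nonzero value there is nonzero as a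
  rational function of x and y, and this in turn, through \<open>specialize\<close>, shows that its
  counterpart in \<open>K\<close> is nonzero.\<close>

interpretation origin: frac_hom "xy_eval 0 0"
  by unfold_locales

lemma origin_vals:
  "frac_val (xy_eval 0 0) (xy_const a) a" "frac_val (xy_eval 0 0) xy_x 0" "frac_val (xy_eval 0 0) xy_y 0"
  using origin.frac_val_to_fract[of "[:[:a:]:]"] origin.frac_val_to_fract[of "[:[:0, 1:]:]"]
    origin.frac_val_to_fract[of "[:0, 1:]"]
  by (simp_all add: xy_gens_to_fract xy_eval_def)

interpretation constant_xypoly: poly_eval "\<lambda>a. [:[:a:]:]"
  by unfold_locales (simp_all add: pCons_one)

definition specialize :: "(param \<Rightarrow> complex) \<Rightarrow> var cpoly \<Rightarrow> xyfun" where
  "specialize c P = to_fract (spec_poly c P)"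

lemma frac_hom_specialize: "frac_hom (specialize c)"
proof -
  interpret comm_ring_hom "spec_poly c"
    unfolding spec_poly_def by (rule constant_xypoly.comm_ring_hom_cpoly_eval)
  show ?thesis
    by unfold_locales (simp_all add: specialize_def hom_add hom_mult hom_one)
qed

interpretation specialize: frac_hom "specialize c" for c
  by (rule frac_hom_specialize)

lemma frac_val_specializes_to: "frac_val (specialize c) F G \<Longrightarrow> specializes_to c F G"
  unfolding frac_val_def specializes_to_def specialize_def Fract_conv_to_fract by auto

lemma specialize_gen: "frac_val (specialize c) (K_gen v) (to_fract (spec_var c v))"
  using specialize.frac_val_to_fract[of c "Poly_Mapping.single (Poly_Mapping.single v 1) 1"]
  by (simp only: specialize_def spec_poly_def constant_xypoly.cpoly_eval_gen K_gen_to_fract)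

lemma specialize_gens:
  "frac_val (specialize c) (K_e i) (xy_const (c (e_par i)))"
  "frac_val (specialize c) K_h1 (xy_const (c P_h1))" "frac_val (specialize c) K_h2 (xy_const (c P_h2))"
  "frac_val (specialize c) K_x xy_x" "frac_val (specialize c) K_y xy_y"
  unfolding K_defs xy_gens_to_fract
  using specialize_gen[of c "Par _"] specialize_gen[of c Var_x] specialize_gen[of c Var_y]
  by simp_all

lemma (in pencil) core_nondeg_at_0: "core_nondeg r k (poly n 0) (poly d 0) 0"
  using r k at_0 den_at_0 by (simp add: core_nondeg_def core_den_def b0_def)

text \<open>The homomorphism \<tau> sends the variable of the polynomials to y for the first
  equation and to x for the second one; \<open>u\<close> is the other variable.\<close>

lemma (in pencil) core_solution_pencil:
  fixes \<tau> :: "complex poly \<Rightarrow> 'f::field"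
  assumes "comm_ring_hom \<tau>" "\<tau> [:0, 1:] \<noteq> 0"
  shows "core_solution (\<tau> [:r:]) (\<tau> [:k:]) (\<tau> n) (\<tau> d) (u * \<tau> [:0, 1:]) / \<tau> [:0, 1:]
    = (\<tau> a0 + u * \<tau> a1) / (\<tau> b0 + u * \<tau> b1)"
proof -
  interpret \<tau>: comm_ring_hom \<tau> by fact
  define t where "t = \<tau> [:0, 1:]"
  have smult: "\<tau> (smult a p) = \<tau> [:a:] * \<tau> p" for a p
    using \<tau>.hom_mult[of "[:a:]" p] by simp
  have pCons: "\<tau> (pCons 0 p) = t * \<tau> p" for p
    using \<tau>.hom_mult[of "[:0, 1:]" p] by (simp add: t_def)
  have a0': "t * \<tau> a0 = \<tau> [:r:] * \<tau> n - \<tau> [:k:] * \<tau> d"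
    using arg_cong[OF a0, of \<tau>] by (simp add: pCons smult \<tau>.hom_diff)
  have "(u * t - \<tau> [:k:]) * \<tau> d - \<tau> [:r:] * \<tau> n * (u * t - 1) = t * (\<tau> a0 + u * \<tau> a1)"
    unfolding distrib_left a0' by (simp add: a1_def \<tau>.hom_diff smult algebra_simps)
  moreover have "core_den (\<tau> [:k:]) (\<tau> n) (\<tau> d) (u * t) = \<tau> b0 + u * \<tau> b1"
    by (simp add: core_den_def b0_def b1_def pCons \<tau>.hom_diff smult algebra_simps)
  ultimately show ?thesis
    using assms(2) by (simp add: core_solution_def flip: t_def)
qed

text \<open>Here \<open>h_distinct\<close> says k \<noteq> 1, and \<open>h_e\<close> says that q h2
  / h1 and q h1 / h2 differ from 1. The conditions \<open>e_e\<close> exclude common roots of the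
  two products in either equation and, together with \<open>e_distinct\<close>, keep the eight
  points apart.\<close>

locale generic_params =
  fixes c :: "param \<Rightarrow> complex"
  assumes e_nonzero: "i \<in> {1..8} \<Longrightarrow> c (e_par i) \<noteq> 0"
    and h_nonzero: "c P_h1 \<noteq> 0" "c P_h2 \<noteq> 0"
    and h_distinct: "c P_h1 \<noteq> c P_h2"
    and h_e: "c P_h1 * c P_h2 ^ 3 \<noteq> (\<Prod>i=1..8. c (e_par i))"
      "c P_h1 ^ 3 * c P_h2 \<noteq> (\<Prod>i=1..8. c (e_par i))"
    and e_distinct: "i \<in> {1..8} \<Longrightarrow> j \<in> {1..8} \<Longrightarrow> i \<noteq> j \<Longrightarrow> c (e_par i) \<noteq> c (e_par j)"
    and e_e: "i \<in> {1..8} \<Longrightarrow> j \<in> {1..8} \<Longrightarrow> c (e_par i) * c (e_par j) \<noteq> c P_h1"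
      "i \<in> {1..8} \<Longrightarrow> j \<in> {1..8} \<Longrightarrow> c (e_par i) * c (e_par j) \<noteq> c P_h2"
begin

abbreviation "e i \<equiv> c (e_par i)"
abbreviation "h1 \<equiv> c P_h1"
abbreviation "h2 \<equiv> c P_h2"
abbreviation "xy_e \<equiv> \<lambda>i. xy_const (e i)"
abbreviation "xy_h1 \<equiv> xy_const h1"
abbreviation "xy_h2 \<equiv> xy_const h2"

definition "Q = q_of e h1 h2"

lemma prod_e_nonzero: "(\<Prod>i=1..8. e i) \<noteq> 0" "(\<Prod>i=1..4. e i) \<noteq> 0" "(\<Prod>i=5..8. e i) \<noteq> 0"
  using e_nonzero by (auto simp: prod_zero_iff)

lemma Q_nonzero: "Q \<noteq> 0"
  using h_nonzero prod_e_nonzero(1) by (simp add: Q_def q_of_def)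

lemma Q_eq: "Q * ((\<Prod>i=1..4. e i) * (\<Prod>i=5..8. e i)) = h1\<^sup>2 * h2\<^sup>2"
  unfolding Q_def q_of_def prod_1_8_split using prod_e_nonzero(2,3) by simp

lemma Q_neq: "Q * h2 / h1 \<noteq> 1" "Q * h1 / h2 \<noteq> 1"
  using h_e h_nonzero prod_e_nonzero(1)
  by (auto simp: Q_def q_of_def field_simps eval_nat_numeral)

definition "n1 = (\<Prod>i=1..4. [:- e i / h2, 1:])"
definition "d1 = (\<Prod>i=5..8. [:- 1 / e i, 1:])"
definition "n2 = smult (Q * h1 / h2) (\<Prod>i=1..4. [:- 1, e i / h1:])"
definition "d2 = smult (h2 / h1) (\<Prod>i=5..8. [:- 1, 1 / e i:])"

lemma poly_n1: "poly n1 t = eq1_n e h2 t" and poly_d1: "poly d1 t = eq1_d e t"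
  and poly_n2: "poly n2 t = eq2_n e h1 h2 t" and poly_d2: "poly d2 t = eq2_d e h1 h2 t"
  by (simp_all add: n1_def d1_def n2_def d2_def poly_prod eq1_n_def eq1_d_def eq2_n_def eq2_d_def Q_def mult.commute)

lemma quartic_prod:
  assumes "finite I" "card I = 4" "\<And>i. i \<in> I \<Longrightarrow> b i \<noteq> (0::complex)"
  shows "degree (\<Prod>i\<in>I. [:a i, b i:]) = 4" "coeff (\<Prod>i\<in>I. [:a i, b i:]) 4 = (\<Prod>i\<in>I. b i)"
proof -
  have "degree (\<Prod>i\<in>I. [:a i, b i:]) = (\<Sum>i\<in>I. degree [:a i, b i:])"
    using assms by (intro degree_prod_eq_sum_degree) auto
  also have "\<dots> = (\<Sum>i\<in>I. 1)"
    using assms(3) by (intro sum.cong) auto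
  finally show deg: "degree (\<Prod>i\<in>I. [:a i, b i:]) = 4"
    using assms(2) by simp
  have "coeff (\<Prod>i\<in>I. [:a i, b i:]) 4 = lead_coeff (\<Prod>i\<in>I. [:a i, b i:])"
    by (simp only: deg)
  also have "\<dots> = (\<Prod>i\<in>I. b i)"
    unfolding lead_coeff_prod using assms(3) by (intro prod.cong) auto
  finally show "coeff (\<Prod>i\<in>I. [:a i, b i:]) 4 = (\<Prod>i\<in>I. b i)" .
qed

lemma roots1:
  "poly n1 t = 0 \<longleftrightarrow> (\<exists>i\<in>{1..4}. t = e i / h2)" "poly d1 t = 0 \<longleftrightarrow> (\<exists>i\<in>{5..8}. t = 1 / e i)"
  by (simp_all add: poly_n1 poly_d1 eq1_n_def eq1_d_def prod_zero_iff Bex_def)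

lemma roots2:
  "poly n2 t = 0 \<longleftrightarrow> (\<exists>i\<in>{1..4}. t = h1 / e i)" "poly d2 t = 0 \<longleftrightarrow> (\<exists>i\<in>{5..8}. t = e i)"
proof -
  have "e i * t / h1 - 1 = 0 \<longleftrightarrow> t = h1 / e i" if "i \<in> {1..4}" for i
    using e_nonzero[of i] h_nonzero that by (auto simp: field_simps)
  then show "poly n2 t = 0 \<longleftrightarrow> (\<exists>i\<in>{1..4}. t = h1 / e i)"
    using Q_nonzero h_nonzero
    by (simp add: poly_n2 eq2_n_def prod_zero_iff Bex_def flip: Q_def del: atLeastAtMost_iff cong: conj_cong)
  have "t / e i - 1 = 0 \<longleftrightarrow> t = e i" if "i \<in> {5..8}" for i
    using e_nonzero[of i] that by (auto simp: field_simps)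
  then show "poly d2 t = 0 \<longleftrightarrow> (\<exists>i\<in>{5..8}. t = e i)"
    using h_nonzero
    by (simp add: poly_d2 eq2_d_def prod_zero_iff Bex_def del: atLeastAtMost_iff cong: conj_cong)
qed

lemma pCons_0_exists: "poly p (0::complex) = 0 \<Longrightarrow> \<exists>q. pCons 0 q = p"
  by (cases p) auto

lemma pencil1: "\<exists>a0. pencil n1 d1 a0 (h1 / h2) (Q * h2 / h1)"
proof -
  have at_0: "poly n1 0 = (\<Prod>i=1..4. e i) / h2 ^ 4" "poly d1 0 = 1 / (\<Prod>i=5..8. e i)"
    by (simp_all add: poly_n1 poly_d1 eq1_n_def eq1_d_def prods eval_nat_numeral)
  \<comment> \<open>Divisibility by the variable, r n(0) = k d(0), is here the defining relation of
    \<open>Q\<close>.\<close>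
  have "poly (smult (Q * h2 / h1) n1 - smult (h1 / h2) d1) 0 = 0"
    using h_nonzero prod_e_nonzero Q_eq by (simp add: at_0 field_simps eval_nat_numeral)
  then obtain a0 where a0: "pCons 0 a0 = smult (Q * h2 / h1) n1 - smult (h1 / h2) d1"
    using pCons_0_exists by blast
  have "pencil n1 d1 a0 (h1 / h2) (Q * h2 / h1)"
  proof
    show "degree n1 \<le> 4" "degree d1 \<le> 4" "coeff n1 4 = coeff d1 4" "coeff d1 4 \<noteq> 0"
      unfolding n1_def d1_def by (simp_all add: quartic_prod)
    show "pCons 0 a0 = smult (Q * h2 / h1) n1 - smult (h1 / h2) d1"
      by (rule a0)
    show "poly n1 0 \<noteq> 0" "poly d1 0 \<noteq> 0" "h1 / h2 \<noteq> 0" "h1 / h2 \<noteq> 1" "Q * h2 / h1 \<noteq> 1"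
      using at_0 h_nonzero h_distinct prod_e_nonzero Q_neq by simp_all
    show "poly d1 t \<noteq> 0" if "poly n1 t = 0" for t
    proof
      assume "poly d1 t = 0"
      with that obtain i j where "i \<in> {1..4}" "j \<in> {5..8}" and ij: "e i / h2 = 1 / e j"
        unfolding roots1 by metis
      then have range: "i \<in> {1..8}" "j \<in> {1..8}"
        by auto
      have "e i * e j = h2"
        using ij range h_nonzero e_nonzero[of j] by (simp add: field_simps)
      then show False
        using e_e(2) range by blast
    qed
  qed
  then show ?thesis ..
qed

lemma pencil2: "\<exists>a0. pencil n2 d2 a0 (h1 / h2) (1 / (Q * h1 / h2))"
proof -
  have at_0: "poly n2 0 = Q * h1 / h2" "poly d2 0 = h2 / h1"
    by (simp_all add: poly_n2 poly_d2 eq2_n_def eq2_d_def prods flip: Q_def)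
  have "poly (smult (1 / (Q * h1 / h2)) n2 - smult (h1 / h2) d2) 0 = 0"
    using h_nonzero Q_nonzero by (simp add: at_0)
  then obtain a0 where a0: "pCons 0 a0 = smult (1 / (Q * h1 / h2)) n2 - smult (h1 / h2) d2"
    using pCons_0_exists by blast
  have "pencil n2 d2 a0 (h1 / h2) (1 / (Q * h1 / h2))"
  proof
    have n: "degree (\<Prod>i=1..4. [:- 1, e i / h1:]) = 4"
      "coeff (\<Prod>i=1..4. [:- 1, e i / h1:]) 4 = (\<Prod>i=1..4. e i / h1)"
      using quartic_prod[of "{1..4}" "\<lambda>i. e i / h1" "\<lambda>_. - 1"] e_nonzero h_nonzero by auto
    have d: "degree (\<Prod>i=5..8. [:- 1, 1 / e i:]) = 4"
      "coeff (\<Prod>i=5..8. [:- 1, 1 / e i:]) 4 = (\<Prod>i=5..8. 1 / e i)"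
      using quartic_prod[of "{5..8}" "\<lambda>i. 1 / e i" "\<lambda>_. - 1"] e_nonzero by auto
    show "degree n2 \<le> 4" "degree d2 \<le> 4"
      unfolding n2_def d2_def using n d by (simp_all del: One_nat_def)
    have n4: "coeff n2 4 = Q * h1 / h2 * ((\<Prod>i=1..4. e i) / h1 ^ 4)"
      unfolding n2_def coeff_smult n by (simp add: prods eval_nat_numeral)
    have d4: "coeff d2 4 = h2 / h1 * (1 / (\<Prod>i=5..8. e i))"
      unfolding d2_def coeff_smult d by (simp add: prods)
    \<comment> \<open>For the second equation both sides of r n(0) = k d(0) are 1 by normalization;
      the defining relation of \<open>Q\<close> enters through the coefficients of degree 4
      instead.\<close>
    show "coeff n2 4 = coeff d2 4"
      unfolding n4 d4 using Q_eq h_nonzero prod_e_nonzero by (simp add: field_simps eval_nat_numeral)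
    show "coeff d2 4 \<noteq> 0"
      unfolding d4 using h_nonzero prod_e_nonzero by simp
    show "pCons 0 a0 = smult (1 / (Q * h1 / h2)) n2 - smult (h1 / h2) d2"
      by (rule a0)
    show "poly n2 0 \<noteq> 0" "poly d2 0 \<noteq> 0"
      unfolding at_0 using h_nonzero Q_nonzero by simp_all
    show "h1 / h2 \<noteq> 0" "h1 / h2 \<noteq> 1" "1 / (Q * h1 / h2) \<noteq> 1"
      using h_nonzero h_distinct Q_nonzero Q_neq by (simp_all add: field_simps)
    show "poly d2 t \<noteq> 0" if "poly n2 t = 0" for t
    proof
      assume "poly d2 t = 0"
      with that obtain i j where "i \<in> {1..4}" "j \<in> {5..8}" and ij: "h1 / e i = e j"
        unfolding roots2 by metis
      then have range: "i \<in> {1..8}" "j \<in> {1..8}"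
        by auto
      have "e i * e j = h1"
        using ij range e_nonzero[of i] by (simp add: field_simps)
      then show False
        using e_e(1) range by blast
    qed
  qed
  then show ?thesis ..
qed

lemma xy_e_nonzero: "i \<in> {1..8} \<Longrightarrow> xy_e i \<noteq> 0" "xy_h1 \<noteq> 0" "xy_h2 \<noteq> 0"
  using e_nonzero h_nonzero by (simp_all add: xy_const.hom_eq_0_iff)

lemma nondeg1_origin:
  "core_nondeg (eq1_r e h1 h2) (h1 / h2) (eq1_n e h2 0) (eq1_d e 0) (0 * 0)"
  using pencil1 pencil.core_nondeg_at_0 by (fastforce simp: poly_n1 poly_d1 eq1_r_def Q_def)

lemma nondeg2_origin:
  "core_nondeg (eq2_r e h1 h2) (h1 / h2) (eq2_n e h1 h2 0) (eq2_d e h1 h2 0) (0 * 0)"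
  using pencil2 pencil.core_nondeg_at_0 by (fastforce simp: poly_n2 poly_d2 eq2_r_def Q_def)

lemma nondeg1_xy:
  "core_nondeg (eq1_r xy_e xy_h1 xy_h2) (xy_h1 / xy_h2) (eq1_n xy_e xy_h2 xy_y) (eq1_d xy_e xy_y) (xy_x * xy_y)"
  by (rule origin.eq1_transfer(1)[OF origin_vals(1,1,1,2,3) e_nonzero h_nonzero nondeg1_origin])

lemma nondeg2_xy:
  "core_nondeg (eq2_r xy_e xy_h1 xy_h2) (xy_h1 / xy_h2) (eq2_n xy_e xy_h1 xy_h2 xy_x)
     (eq2_d xy_e xy_h1 xy_h2 xy_x) (xy_x * xy_y)"
  by (rule origin.eq2_transfer(1)[OF origin_vals(1,1,1,2,3) e_nonzero h_nonzero nondeg2_origin])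

lemma equation1_xy_iff: "xy_equation1 xy_e xy_h1 xy_h2 xy_x xy_y F \<longleftrightarrow> F = solution1 xy_e xy_h1 xy_h2 xy_x xy_y"
  by (rule xy_equation1_iff[OF nondeg1_xy xy_nonzero(2)])

lemma equation2_xy_iff: "xy_equation2 xy_e xy_h1 xy_h2 xy_x xy_y F \<longleftrightarrow> F = solution2 xy_e xy_h1 xy_h2 xy_x xy_y"
  by (rule xy_equation2_iff[OF nondeg2_xy xy_nonzero(1) xy_e_nonzero(2,3)])

lemma specializes_T_inv_x: "specializes_to c (inv T K_x) (solution1 xy_e xy_h1 xy_h2 xy_x xy_y)"
proof -
  \<comment> \<open>Nondegeneracy for the specialized functions lifts to \<open>K\<close>, where it
    makes T^(-1)(x) the only solution. The solution formula is then specialized factor by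
    factor.\<close>
  note transfer = specialize.eq1_transfer[OF specialize_gens xy_e_nonzero nondeg1_xy]
  have "inv T K_x = solution1 K_e K_h1 K_h2 K_x K_y"
    using xy_equation1_iff[OF transfer(1)] equation1_T by simp
  then show ?thesis
    unfolding solution1_def
    by (auto intro!: frac_val_specializes_to specialize.frac_val_divide transfer(2) specialize_gens xy_nonzero)
qed

lemma specializes_T_y: "specializes_to c (T K_y) (solution2 xy_e xy_h1 xy_h2 xy_x xy_y)"
proof -
  note transfer = specialize.eq2_transfer[OF specialize_gens xy_e_nonzero nondeg2_xy]
  have "T K_y = solution2 K_e K_h1 K_h2 K_x K_y"
    using xy_equation2_iff[OF transfer(1)] equation2_T by simp
  then show ?thesis
    unfolding solution2_def
    by (auto intro!: frac_val_specializes_to specialize.frac_val_divide transfer(2) specialize_gens xy_nonzero)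
qed

lemma indeterminate_solution1:
  "{p. indeterminate_at (solution1 xy_e xy_h1 xy_h2 xy_x xy_y) p} = eight_points c"
proof -
  obtain a0 where "pencil n1 d1 a0 (h1 / h2) (Q * h2 / h1)"
    using pencil1 by blast
  then interpret p: pencil n1 d1 a0 "h1 / h2" "Q * h2 / h1" .
  define \<tau> where "\<tau> p = to_fract (y_poly p)" for p
  interpret \<tau>: comm_ring_hom \<tau>
    by unfold_locales (simp_all add: \<tau>_def y_poly.hom_add y_poly.hom_mult y_poly.hom_one)
  have const: "\<tau> [:a:] = xy_const a" and y: "\<tau> [:0, 1:] = xy_y" for a
    by (simp_all add: \<tau>_def xy_gens_to_fract y_poly_def map_poly_pCons pCons_one)
  have linear: "\<tau> [:a, 1:] = xy_const a + xy_y" for a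
    using \<tau>.hom_add[of "[:a:]" "[:0, 1:]"] by (simp add: const y)
  have n: "\<tau> n1 = eq1_n xy_e xy_h2 xy_y" and d: "\<tau> d1 = eq1_d xy_e xy_y"
    by (simp_all add: n1_def d1_def \<tau>.hom_prod linear eq1_n_def eq1_d_def xy_const.hom_divide
        xy_const.hom_uminus xy_const.hom_one)
  have r: "\<tau> [:Q * h2 / h1:] = eq1_r xy_e xy_h1 xy_h2" and k: "\<tau> [:h1 / h2:] = xy_h1 / xy_h2"
    by (simp_all add: const Q_def eq1_r_def q_of_def xy_const.hom_divide xy_const.hom_mult
        xy_const.hom_power xy_const.hom_prod)
  have "solution1 xy_e xy_h1 xy_h2 xy_x xy_y
      = (\<tau> a0 + xy_x * \<tau> p.a1) / (\<tau> p.b0 + xy_x * \<tau> p.b1)"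
    using p.core_solution_pencil[OF \<tau>.comm_ring_hom_axioms, of xy_x] xy_nonzero
    by (simp add: solution1_def y n d r k)
  also have "\<dots> = Fraction_Field.Fract (linear_in_x a0 p.a1) (linear_in_x p.b0 p.b1)"
    by (simp only: Fract_conv_to_fract linear_in_x_def \<tau>_def xy_gens_to_fract to_fract_add to_fract_mult)
  finally have "indeterminate_at (solution1 xy_e xy_h1 xy_h2 xy_x xy_y) (x, y) \<longleftrightarrow>
      (\<exists>t. y = Affine t \<and> (poly n1 t = 0 \<and> x = Affine (h1 / h2 / t) \<or> poly d1 t = 0 \<and> x = Affine (1 / t)))"
    for x y
    by (simp only: p.indeterminate_linear_in_x)
  also have "\<dots> x y \<longleftrightarrow> (x, y) \<in> eight_points c" for x y
    unfolding roots1 eight_points_def using h_nonzero e_nonzero by auto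
  finally show ?thesis
    by auto
qed

lemma indeterminate_solution2:
  "{p. indeterminate_at (solution2 xy_e xy_h1 xy_h2 xy_x xy_y) p} = eight_points c"
proof -
  obtain a0 where "pencil n2 d2 a0 (h1 / h2) (1 / (Q * h1 / h2))"
    using pencil2 by blast
  then interpret p: pencil n2 d2 a0 "h1 / h2" "1 / (Q * h1 / h2)" .
  define \<tau> where "\<tau> p = to_fract (x_poly p)" for p
  interpret \<tau>: comm_ring_hom \<tau>
    by unfold_locales (simp_all add: \<tau>_def x_poly.hom_add x_poly.hom_mult x_poly.hom_one)
  have const: "\<tau> [:a:] = xy_const a" and x: "\<tau> [:0, 1:] = xy_x" for a
    by (simp_all add: \<tau>_def xy_gens_to_fract x_poly_def)
  have linear: "\<tau> [:a, b:] = xy_const a + xy_const b * xy_x" for a b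
    using \<tau>.hom_add[of "[:a:]" "[:b:] * [:0, 1:]"] by (simp add: const x \<tau>.hom_mult[of "[:b:]" "[:0, 1:]", simplified])
  have smult: "\<tau> (smult a p) = xy_const a * \<tau> p" for a p
    using \<tau>.hom_mult[of "[:a:]" p] by (simp add: const)
  have q: "xy_const Q = q_of xy_e xy_h1 xy_h2"
    by (simp add: Q_def q_of_def xy_const.hom_divide xy_const.hom_mult xy_const.hom_power xy_const.hom_prod)
  note homs = xy_const.hom_divide xy_const.hom_mult xy_const.hom_uminus xy_const.hom_one q
  have n: "\<tau> n2 = eq2_n xy_e xy_h1 xy_h2 xy_x" and d: "\<tau> d2 = eq2_d xy_e xy_h1 xy_h2 xy_x"
    by (simp_all add: n2_def d2_def smult \<tau>.hom_prod linear eq2_n_def eq2_d_def homs)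
  have r: "\<tau> [:1 / (Q * h1 / h2):] = eq2_r xy_e xy_h1 xy_h2" and k: "\<tau> [:h1 / h2:] = xy_h1 / xy_h2"
    by (simp_all add: const eq2_r_def homs)
  have "solution2 xy_e xy_h1 xy_h2 xy_x xy_y
      = (\<tau> a0 + xy_y * \<tau> p.a1) / (\<tau> p.b0 + xy_y * \<tau> p.b1)"
    using p.core_solution_pencil[OF \<tau>.comm_ring_hom_axioms, of xy_y, unfolded x n d r k] xy_nonzero
    by (simp add: solution2_def mult.commute)
  also have "\<dots> = Fraction_Field.Fract (linear_in_y a0 p.a1) (linear_in_y p.b0 p.b1)"
    by (simp only: Fract_conv_to_fract linear_in_y_def \<tau>_def xy_gens_to_fract to_fract_add to_fract_mult)
  finally have "indeterminate_at (solution2 xy_e xy_h1 xy_h2 xy_x xy_y) (x, y) \<longleftrightarrow>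
      (\<exists>t. x = Affine t \<and> (poly n2 t = 0 \<and> y = Affine (h1 / h2 / t) \<or> poly d2 t = 0 \<and> y = Affine (1 / t)))"
    for x y
    by (simp only: p.indeterminate_linear_in_y)
  also have "\<dots> x y \<longleftrightarrow> (x, y) \<in> eight_points c" for x y
    unfolding roots2 eight_points_def using h_nonzero e_nonzero by auto
  finally show ?thesis
    by auto
qed

lemma card_eight_points: "card (eight_points c) = 8"
proof -
  define P where "P i = (if i \<le> 4 then (Affine (h1 / e i), Affine (e i / h2)) else (Affine (e i), Affine (1 / e i)))"
    for i :: nat
  have "eight_points c = P ` {1..4} \<union> P ` {5..8}"
    unfolding eight_points_def P_def by (auto simp: image_iff)
  also have "\<dots> = P ` {1..8}"
    by (simp only: image_Un[symmetric]) (rule arg_cong[of _ _ "(`) P"], auto)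
  finally have eq: "eight_points c = P ` {1..8}" .
  have "inj_on P {1..8}"
  proof (rule inj_onI, rule ccontr)
    fix i j assume ij: "i \<in> {1..8}" "j \<in> {1..8}" "P i = P j" "i \<noteq> j"
    \<comment> \<open>Within a block the e_i separate the points. Across the blocks the second
      coordinates differ, as their equality would mean that a product of two e_i is h2.\<close>
    have "e i \<noteq> e j" "e i * e j \<noteq> h2" "e j * e i \<noteq> h2" "e i \<noteq> 0" "e j \<noteq> 0"
      using e_distinct e_e e_nonzero ij by auto
    then show False
      using ij(3) h_nonzero by (auto simp: P_def field_simps split: if_splits)
  qed
  then show ?thesis
    by (simp add: eq card_image)
qed

end

lemma generic_specialization:
  assumes "generic_params c"
  shows "\<exists>F G.
    specializes_to c (inv T K_x) F \<and> specializes_to c (T K_y) G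
    \<and> (\<forall>F'. xy_equation1 (\<lambda>i. xy_const (c (e_par i))) (xy_const (c P_h1)) (xy_const (c P_h2))
              xy_x xy_y F' \<longleftrightarrow> F' = F)
    \<and> (\<forall>G'. xy_equation2 (\<lambda>i. xy_const (c (e_par i))) (xy_const (c P_h1)) (xy_const (c P_h2))
              xy_x xy_y G' \<longleftrightarrow> G' = G)
    \<and> {p. indeterminate_at F p} = eight_points c
    \<and> {p. indeterminate_at G p} = eight_points c
    \<and> card (eight_points c) = 8"
proof -
  interpret generic_params c by fact
  show ?thesis
    using specializes_T_inv_x specializes_T_y equation1_xy_iff equation2_xy_iff
      indeterminate_solution1 indeterminate_solution2 card_eight_points by blast
qed

section \<open>Genericity\<close>

text \<open>The genericity condition can thus be written as an ordinary expression in the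
  parameters, and closure rules supply the formal polynomial.\<close>

definition param_poly_fun :: "((param \<Rightarrow> complex) \<Rightarrow> complex) \<Rightarrow> bool" where
  "param_poly_fun g \<longleftrightarrow> (\<exists>D. \<forall>c. cpoly_eval (\<lambda>a. a) c D = g c)"

lemma generically_nonzeroI:
  assumes "param_poly_fun g" "g c0 \<noteq> 0" "\<And>c. g c \<noteq> 0 \<Longrightarrow> P c"
  shows "generically P"
proof -
  obtain D where D: "\<And>c. cpoly_eval (\<lambda>a. a) c D = g c"
    using assms(1) by (auto simp: param_poly_fun_def)
  then have "D \<noteq> 0"
    using assms(2) C_id.cpoly_eval_0[of c0] by auto
  then show ?thesis
    unfolding generically_def using D assms(3) by auto
qed

lemma param_poly_fun_param: "param_poly_fun (\<lambda>c. c p)"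
  unfolding param_poly_fun_def by (intro exI allI, rule C_id.cpoly_eval_gen)

lemma param_poly_fun_const: "param_poly_fun (\<lambda>c. a)"
  unfolding param_poly_fun_def by (intro exI allI, rule C_id.cpoly_eval_const)

lemma param_poly_fun_mult: "param_poly_fun f \<Longrightarrow> param_poly_fun g \<Longrightarrow> param_poly_fun (\<lambda>c. f c * g c)"
  unfolding param_poly_fun_def by (metis C_id.cpoly_eval_mult)

lemma param_poly_fun_diff: "param_poly_fun f \<Longrightarrow> param_poly_fun g \<Longrightarrow> param_poly_fun (\<lambda>c. f c - g c)"
  unfolding param_poly_fun_def
  by (metis comm_ring_hom.hom_diff[OF C_id.comm_ring_hom_cpoly_eval])

lemma param_poly_fun_power: "param_poly_fun f \<Longrightarrow> param_poly_fun (\<lambda>c. f c ^ n)"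
  by (induction n) (auto intro: param_poly_fun_const param_poly_fun_mult)

lemma param_poly_fun_prod:
  "(\<And>i. i \<in> S \<Longrightarrow> param_poly_fun (f i)) \<Longrightarrow> param_poly_fun (\<lambda>c. \<Prod>i\<in>S. f i c)"
  by (induction S rule: infinite_finite_induct) (auto intro: param_poly_fun_const param_poly_fun_mult)

definition generic_poly :: "(param \<Rightarrow> complex) \<Rightarrow> complex" where
  "generic_poly c =
     (\<Prod>i=1..8. c (e_par i)) * (c P_h1 * c P_h2 * (c P_h1 - c P_h2))
     * ((c P_h1 * c P_h2 ^ 3 - (\<Prod>i=1..8. c (e_par i))) * (c P_h1 ^ 3 * c P_h2 - (\<Prod>i=1..8. c (e_par i))))
     * (\<Prod>i=1..8. \<Prod>j\<in>{1..8} - {i}. c (e_par i) - c (e_par j))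
     * (\<Prod>i=1..8. \<Prod>j=1..8. (c (e_par i) * c (e_par j) - c P_h1) * (c (e_par i) * c (e_par j) - c P_h2))"

lemma param_poly_fun_generic_poly: "param_poly_fun generic_poly"
  unfolding generic_poly_def
  by (intro param_poly_fun_mult param_poly_fun_prod param_poly_fun_diff param_poly_fun_power
      param_poly_fun_param)

lemma generic_params_if_generic_poly: "generic_poly c \<noteq> 0 \<Longrightarrow> generic_params c"
  unfolding generic_poly_def by unfold_locales (auto simp: prod_zero_iff)

text \<open>Negative values of h1 and h2 keep them away from all products e_i e_j = i j. Moreover h1
  h2^3 = 8 and h1^3 h2 = 2 differ from e1 ... e8 = 40320.\<close>

definition generic_point :: "param \<Rightarrow> complex" where
  "generic_point p = (case p of P_h1 \<Rightarrow> - 1 | P_h2 \<Rightarrow> - 2 | _ \<Rightarrow> of_nat (param_rank p))"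

lemma generic_point_e: "i \<in> {1..8} \<Longrightarrow> generic_point (e_par i) = of_nat i"
  unfolding range_1_8 by (auto simp: generic_point_def)

lemma generic_poly_generic_point: "generic_poly generic_point \<noteq> 0"
proof -
  have h: "generic_point P_h1 = - 1" "generic_point P_h2 = - 2"
    by (simp_all add: generic_point_def)
  have prod: "(\<Prod>i=1..8. generic_point (e_par i)) = 40320"
    by (simp add: generic_point_e[simplified] prods)
  have diff: "generic_point (e_par i) - generic_point (e_par j) \<noteq> 0"
    if "i \<in> {1..8}" "j \<in> {1..8} - {i}" for i j
    using that by (auto simp: generic_point_e)
  have pos: "of_nat m + 1 \<noteq> (0::complex)" "of_nat m + 2 \<noteq> (0::complex)" for m
    using of_nat_neq_0[of m, where 'a = complex] of_nat_neq_0[of "Suc m", where 'a = complex]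
    by (simp_all add: add.commute)
  have e_e: "(generic_point (e_par i) * generic_point (e_par j) - generic_point P_h1)
      * (generic_point (e_par i) * generic_point (e_par j) - generic_point P_h2) \<noteq> 0"
    if "i \<in> {1..8}" "j \<in> {1..8}" for i j
    using that pos[of "i * j"] by (simp add: generic_point_e h)
  show ?thesis
    unfolding generic_poly_def prod using diff e_e
    by (simp add: h prod_zero_iff)
qed

theorem proposition4p1p1:
  shows
    "xy_equation1 K_e K_h1 K_h2 K_x K_y (inv T K_x)
     \<and> xy_equation2 K_e K_h1 K_h2 K_x K_y (T K_y)
     \<and> (\<forall>x y X Y :: L. x \<noteq> 0 \<and> y \<noteq> 0 \<and> X \<noteq> 0 \<and> Y \<noteq> 0 \<longrightarrow>
          (xy_equation1 (\<lambda>i. L_of (K_e i)) (L_of K_h1) (L_of K_h2) x y X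
           \<and> xy_equation2 (\<lambda>i. L_of (K_e i)) (L_of K_h1) (L_of K_h2) x y Y)
          \<longleftrightarrow>
          (qE7_equation1 L_v L_k1 L_k2 L_q (f_of L_lambda y) (g_of L_lambda x)
             (g_of (inv T_L L_lambda) X)
           \<and> qE7_equation2 L_v L_k1 L_k2 L_q (f_of L_lambda y) (g_of L_lambda x)
             (f_of (T_L L_lambda) Y)))
     \<and> (let f = f_of L_lambda (L_of K_y); g = g_of L_lambda (L_of K_x) in
          qE7_equation1 L_v L_k1 L_k2 L_q f g (inv T_L g)
          \<and> qE7_equation2 L_v L_k1 L_k2 L_q f g (T_L f))
     \<and> generically (\<lambda>c. \<exists>F G.
          specializes_to c (inv T K_x) F \<and> specializes_to c (T K_y) G
          \<and> (\<forall>F'. xy_equation1 (\<lambda>i. xy_const (c (e_par i))) (xy_const (c P_h1)) (xy_const (c P_h2))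
                    xy_x xy_y F' \<longleftrightarrow> F' = F)
          \<and> (\<forall>G'. xy_equation2 (\<lambda>i. xy_const (c (e_par i))) (xy_const (c P_h1)) (xy_const (c P_h2))
                    xy_x xy_y G' \<longleftrightarrow> G' = G)
          \<and> {p. indeterminate_at F p} = eight_points c
          \<and> {p. indeterminate_at G p} = eight_points c
          \<and> card (eight_points c) = 8)"
proof (intro conjI allI impI)
  show "xy_equation1 K_e K_h1 K_h2 K_x K_y (inv T K_x)"
    by (rule equation1_T)
  show "xy_equation2 K_e K_h1 K_h2 K_x K_y (T K_y)"
    by (rule equation2_T)
  show "generically (\<lambda>c. \<exists>F G.
          specializes_to c (inv T K_x) F \<and> specializes_to c (T K_y) G
          \<and> (\<forall>F'. xy_equation1 (\<lambda>i. xy_const (c (e_par i))) (xy_const (c P_h1)) (xy_const (c P_h2))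
                    xy_x xy_y F' \<longleftrightarrow> F' = F)
          \<and> (\<forall>G'. xy_equation2 (\<lambda>i. xy_const (c (e_par i))) (xy_const (c P_h1)) (xy_const (c P_h2))
                    xy_x xy_y G' \<longleftrightarrow> G' = G)
          \<and> {p. indeterminate_at F p} = eight_points c
          \<and> {p. indeterminate_at G p} = eight_points c
          \<and> card (eight_points c) = 8)"
    by (rule generically_nonzeroI[OF param_poly_fun_generic_poly generic_poly_generic_point
          generic_specialization[OF generic_params_if_generic_poly]])
qed (use qE7_equation1_L_iff qE7_equation2_L_iff qE7_equation1_T qE7_equation2_T in \<open>simp_all add: Let_def\<close>)

end
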